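(* Assume $\ell=3$. Let $\mathcal{A}$ be a central hyperplane arrangement in $V\cong\mathbb{K}^3$ with defining polynomial $Q$, let $\theta_1,\theta_2,\theta_3,\theta_4\in D(\mathcal{A})$ be homogeneous derivations, and let $g_1,\dots,g_4\in S$ be the polynomials determined by $(-1)^i\det M_i=g_iQ$ for $i=1,\dots,4$. Then $\mathcal{A}$ is SPOG, and the set $\{\theta_1,\theta_2,\theta_3,\theta_4\}$ forms a minimal generating set for $D(\mathcal{A})$ satisfying the minimal degree relation \[ g_1\theta_1+g_2\theta_2+g_3\theta_3+g_4\theta_4=0, \] if and only if $g_4\in S_1\setminus\{0\}$, and the coefficients $g_1,g_2,g_3\in S_{>0}$ have no non-trivial common divisor modulo $g_4$.
   Context: $\mathbb{K}$ is a field, $V\cong\mathbb{K}^\ell$ with $\ell=3$, and $S=\mathrm{Sym}(V^* )\cong\mathbb{K}[x_1,\dots,x_\ell]$ with the standard grading; $S_1$ is the space of linear forms and $S_{>0}=\bigoplus_{d\ge1}S_d$. A central arrangement $\mathcal{A}$ is a finite set of linear hyperplanes in $V$; $\alpha_H\in V^*$ is a defining linear form of $H\in\mathcal{A}$, and $Q=Q(\mathcal{A})=\prod_{H\in\mathcal{A}}\alpha_H$. The module of logarithmic derivations is the graded $S$-module \[ D(\mathcal{A})=\{\theta\in\mathrm{Der}_{\mathbb{K}}(S)=\textstyle\bigoplus_{i=1}^{\ell}S\,\partial_{x_i}\mid\theta(\alpha_H)\in\alpha_HS\text{ for all }H\in\mathcal{A}\}. \] A derivation $\theta$ is homogeneous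 of degree $d$ if all $\theta(x_j)$ lie in $S_d$. For $\theta_1,\dots,\theta_{\ell+1}\in D(\mathcal{A})$, let $M=M[\theta_1,\dots,\theta_{\ell+1}]$ be the $(\ell+1)\times\ell$ matrix with $(i,j)$-entry $\theta_i(x_j)$, and let $M_i$ be the $\ell\times\ell$ matrix obtained from $M$ by deleting the $i$-th row. Every $\det M_i$ is divisible by $Q$ (standard fact), so $g_i\in S$ is well defined by $(-1)^i\det M_i=g_iQ$. A relation $f_1\theta_1+\cdots+f_{\ell+1}\theta_{\ell+1}=0$ in $D(\mathcal{A})$ is of minimal degree (or primitive) if the polynomials $f_1,\dots,f_{\ell+1}$ have no non-trivial common divisor. Polynomials $f_1,\dots,f_p\in S$ have a non-trivial common divisor $h$ modulo $f$ if there exists $h\in S_{>0}$ such that $f_i\in(h,f)$ (the ideal generated by $h$ and $f$) for all $i$. An arrangement $\mathcal{A}$ is strictly plus-one generated (SPOG) if $D(\mathcal{A})$ requires exactly $\ell+1$ minimal homogeneous generators $\varphi_1,\dots,\varphi_{\ell+1}$, which satisfy a unique generating relation $f_1\varphi_1+\cdots+f_{\ell+1}\varphi_{\ell+1}=0$, where $f_1,\dots,f_{\ell+1}\in S$ with $f_{\ell+1}\in S_1\setminus\{0\}$.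
   Formalization: The derivations are taken to be numbered as in the definition of SPOG, so that the generating relation of θ_1,…,θ_4 has a nonzero linear last coefficient; for an arbitrary ordering of the set the "only if" direction fails (generic 4 planes with θ_4 the Euler derivation). *)

theory Defs
  imports "HOL-Analysis.Analysis" "HOL-Computational_Algebra.Polynomial"
begin

text \<open>
  The polynomial ring \<open>S = K[x1, x2, x3]\<close> is represented as the iterated univariate polynomial ring
  \<open>K[x1][x2][x3]\<close>; the outermost variable is \<open>x3\<close>.
\<close>

type_synonym 'k S = "'k poly poly poly"

definition const :: "'k::field \<Rightarrow> 'k S" where
  "const c = [:[:[:c:]:]:]"

definition var :: "('k::field S)^3" where
  "var = vector [ [:[:[:0, 1:]:]:], [:[:0, 1:]:], [:0, 1:] ]"

text \<open>The coefficient of \<open>x1^i x2^j x3^k\<close>.\<close>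

definition mcoeff :: "'k::field S \<Rightarrow> nat \<Rightarrow> nat \<Rightarrow> nat \<Rightarrow> 'k" where
  "mcoeff p i j k = coeff (coeff (coeff p k) j) i"

definition S_deg :: "nat \<Rightarrow> 'k::field S set" where
  "S_deg d = {p. \<forall>i j k. mcoeff p i j k \<noteq> 0 \<longrightarrow> i + j + k = d}"

text \<open>
  The direct sum of all \<open>S_deg d\<close> with \<open>d \<ge> 1\<close>: its elements need not be homogeneous, and \<open>0\<close>
  is one of them.
\<close>

definition S_pos :: "'k::field S set" where
  "S_pos = {p. \<forall>i j k. mcoeff p i j k \<noteq> 0 \<longrightarrow> i + j + k \<ge> 1}"

definition partial :: "'k::field S \<Rightarrow> ('k S)^3" where
  "partial p = vector [map_poly (map_poly pderiv) p, map_poly pderiv p, pderiv p]"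

text \<open>
  Since \<open>Der S\<close> is free on the partial derivatives, a derivation \<open>\<theta>\<close> is represented by the vector
  of its coefficients, so that \<open>\<theta> $ j = \<theta>(x_j)\<close> (see \<open>der_apply_var\<close> below).
\<close>

type_synonym 'k der = "('k poly poly poly)^3"

definition der_apply :: "'k::field der \<Rightarrow> 'k S \<Rightarrow> 'k S" where
  "der_apply \<theta> p = (\<Sum>i\<in>UNIV. \<theta> $ i * partial p $ i)"

lemma der_apply_var: "der_apply \<theta> (var $ j) = \<theta> $ j"
proof -
  have "\<forall>j. der_apply \<theta> (var $ j) = \<theta> $ j"
    unfolding forall_3 der_apply_def sum_3
    by (simp add: var_def partial_def vector_3 pderiv_pCons map_poly_pCons one_pCons)
      (simp flip: one_pCons)
  then show ?thesis by blast
qed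

definition homogeneous_der :: "'k::field der \<Rightarrow> bool" where
  "homogeneous_der \<theta> \<longleftrightarrow> (\<exists>d. \<forall>j. \<theta> $ j \<in> S_deg d)"

definition central_arrangement :: "('k::field^3) set set \<Rightarrow> bool" where
  "central_arrangement A \<longleftrightarrow> finite A \<and> (\<forall>H\<in>A. vec.subspace H \<and> vec.dim H = 2)"

text \<open>A linear form on \<open>V\<close> is given by its coefficients with respect to \<open>x1, x2, x3\<close>.\<close>

definition linear_form :: "'k::field^3 \<Rightarrow> 'k S" where
  "linear_form a = (\<Sum>i\<in>UNIV. const (a $ i) * var $ i)"

definition defines_hyperplane :: "'k::field^3 \<Rightarrow> ('k^3) set \<Rightarrow> bool" where
  "defines_hyperplane a H \<longleftrightarrow> a \<noteq> 0 \<and> H = {v. (\<Sum>i\<in>UNIV. a $ i * v $ i) = 0}"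

definition defining_poly :: "('k::field^3) set set \<Rightarrow> (('k^3) set \<Rightarrow> 'k^3) \<Rightarrow> 'k S" where
  "defining_poly A \<alpha> = (\<Prod>H\<in>A. linear_form (\<alpha> H))"

text \<open>
  The defining form of a hyperplane is unique up to a nonzero scalar, so the condition in
  \<open>log_der\<close> may be imposed for all of its defining forms.
\<close>

definition log_der :: "('k::field^3) set set \<Rightarrow> 'k der set" where
  "log_der A = {\<theta>. \<forall>H\<in>A. \<forall>a. defines_hyperplane a H \<longrightarrow>
     linear_form a dvd der_apply \<theta> (linear_form a)}"

text \<open>
  Families of \<open>l + 1 = 4\<close> derivations or coefficients are functions on \<open>nat\<close>, of which only the
  values at the indices \<open>1, ..., 4\<close> matter. The rows of the \<open>4 \<times> 3\<close> matrix \<open>M\<close> are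
  \<open>\<theta> 1, ..., \<theta> 4\<close>.
\<close>

definition delete_row :: "(nat \<Rightarrow> 'k::field der) \<Rightarrow> nat \<Rightarrow> ('k S)^3^3" where
  "delete_row \<theta> i = vector (map \<theta> (removeAll i [1..<5]))"

definition is_relation :: "(nat \<Rightarrow> 'k::field S) \<Rightarrow> (nat \<Rightarrow> 'k der) \<Rightarrow> bool" where
  "is_relation f \<theta> \<longleftrightarrow> (\<Sum>i=1..4. f i *s \<theta> i) = 0"

definition minimal_degree_relation :: "(nat \<Rightarrow> 'k::field S) \<Rightarrow> (nat \<Rightarrow> 'k der) \<Rightarrow> bool" where
  "minimal_degree_relation f \<theta> \<longleftrightarrow>
     is_relation f \<theta> \<and> (\<forall>h. (\<forall>i\<in>{1..4}. h dvd f i) \<longrightarrow> is_unit h)"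

definition common_divisor_mod :: "'k::field S \<Rightarrow> 'k S set \<Rightarrow> 'k S \<Rightarrow> bool" where
  "common_divisor_mod h F f \<longleftrightarrow> h \<in> S_pos \<and> (\<forall>p\<in>F. \<exists>a b. p = a * h + b * f)"

lemma module_der: "module ((*s) :: 'k::field S \<Rightarrow> 'k der \<Rightarrow> 'k der)"
  by unfold_locales (simp_all add: vector_add_ldistrib vector_sadd_rdistrib vector_smult_assoc)

definition minimal_generating_set :: "('k::field^3) set set \<Rightarrow> 'k der set \<Rightarrow> bool" where
  "minimal_generating_set A B \<longleftrightarrow>
     module.span (*s) B = log_der A \<and> (\<forall>C. C \<subset> B \<longrightarrow> module.span (*s) C \<noteq> log_der A)"

text \<open>The four generators are required to be pairwise distinct, so that there are exactly four.\<close>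

definition minimal_homogeneous_generators ::
    "('k::field^3) set set \<Rightarrow> (nat \<Rightarrow> 'k der) \<Rightarrow> bool" where
  "minimal_homogeneous_generators A \<phi> \<longleftrightarrow>
     inj_on \<phi> {1..4} \<and> (\<forall>i\<in>{1..4}. homogeneous_der (\<phi> i)) \<and>
     minimal_generating_set A (\<phi> ` {1..4})"

text \<open>Uniqueness of the generating relation: every relation is a multiple of it.\<close>

definition generating_relation :: "(nat \<Rightarrow> 'k::field S) \<Rightarrow> (nat \<Rightarrow> 'k der) \<Rightarrow> bool" where
  "generating_relation f \<phi> \<longleftrightarrow>
     is_relation f \<phi> \<and> (\<forall>r. is_relation r \<phi> \<longrightarrow> (\<exists>c. \<forall>i\<in>{1..4}. r i = c * f i))"

text \<open>
  The order of the generators matters here: it is the coefficient of the last one that has to be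
  a nonzero linear form.
\<close>

definition SPOG_generators :: "('k::field^3) set set \<Rightarrow> (nat \<Rightarrow> 'k der) \<Rightarrow> bool" where
  "SPOG_generators A \<phi> \<longleftrightarrow> minimal_homogeneous_generators A \<phi> \<and>
     (\<exists>f. generating_relation f \<phi> \<and> f 4 \<in> S_deg 1 - {0})"

definition SPOG :: "('k::field^3) set set \<Rightarrow> bool" where
  "SPOG A \<longleftrightarrow> (\<exists>\<phi>. SPOG_generators A \<phi>)"

end

theory Submission
  imports Defs "Berlekamp_Zassenhaus.Unique_Factorization_Poly"
begin

no_notation Matrix.vec_index (infixl "$" 100)
hide_const (open) Determinant.det

text \<open>
  Write \<open>[u v w]\<close> for the determinant with rows \<open>u\<close>, \<open>v\<close>, \<open>w\<close>. If these are logarithmic, then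
  \<open>Q\<close> divides \<open>[u v w]\<close> (\<open>Q_dvd_det\<close>), and Cramer's rule for four vectors in a space of
  dimension three, divided by \<open>Q\<close>, is the relation \<open>\<Sum> g_i \<theta>_i = 0\<close>.

  Suppose that \<open>g_4\<close> is a nonzero linear form and that \<open>g_1, g_2, g_3\<close> have no common divisor modulo
  \<open>g_4\<close>. Then \<open>\<theta>_1, \<theta>_2, \<theta>_3\<close> are independent, so a relation is determined by its last
  coefficient; as \<open>g_4\<close> is prime and does not divide all \<open>g_i\<close>, every relation is a
  multiple of \<open>g\<close>. As no \<open>g_i\<close> has a constant term, no coefficient of a relation is \<open>-1\<close>, so no
  \<open>\<theta>_i\<close> is a combination of the others.

  The essential point is generation. For a logarithmic \<open>\<eta>\<close>, Cramer's rule divided by \<open>Q\<close> gives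
  \<open>g_4 \<eta> = c_1 \<theta>_1 + c_2 \<theta>_2 + c_3 \<theta>_3\<close>, and a Pluecker relation divided by \<open>Q^2\<close> gives
  \<open>c_i g_j = c_j g_i\<close> modulo \<open>g_4\<close> (\<open>cramer_coefficients\<close>). The ring \<open>S/(g_4)\<close> is a polynomial
  ring in two variables, hence factorial, and the homogeneous \<open>g_1, g_2, g_3\<close> are coprime there;
  so \<open>c_i = t g_i\<close> modulo \<open>g_4\<close> for a single \<open>t\<close> (\<open>proportional_mod_linear_form\<close>). Subtracting \<open>t\<close> times the
  relation \<open>g\<close> leaves only coefficients divisible by \<open>g_4\<close>, and dividing by \<open>g_4\<close> writes \<open>\<eta>\<close> as a
  combination of the \<open>\<theta>_i\<close>.

  Conversely, let the \<open>\<theta>_i\<close> be SPOG generators and \<open>g\<close> a relation of minimal degree. Then \<open>g\<close> is a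
  unit multiple of the generating relation, so \<open>g_4\<close> is a linear form, and a \<open>g_i\<close> with nonzero
  constant term would be a unit by homogeneity and make \<open>\<theta>_i\<close> superfluous. If
  \<open>g_i = a_i h + b_i g_4\<close> for \<open>i \<le> 3\<close>, then \<open>h \<Sum> a_i \<theta>_i = - g_4 (\<theta>_4 + \<Sum> b_i \<theta>_i)\<close>.
  The prime \<open>g_4\<close> does not divide \<open>h\<close>, so \<open>\<Sum> a_i \<theta>_i = g_4 \<psi>\<close>. Both \<open>g_4 \<psi>\<close> and
  \<open>h \<psi> = - (\<theta>_4 + \<Sum> b_i \<theta>_i)\<close> are logarithmic, hence so is \<open>\<psi>\<close>
  (\<open>log_der_of_two_multiples\<close>). Expanding \<open>\<psi>\<close> in the generators gives a relation in which
  \<open>\<theta>_4\<close> has a coefficient with constant term \<open>1\<close>, whereas it must be a multiple of \<open>g_4\<close>.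

  Two devices keep the algebra inside \<open>S\<close> and \<open>S[T]\<close>. The quotient by a linear form \<open>l\<close> is replaced by an
  endomorphism of \<open>S\<close> with kernel \<open>(l)\<close> that is the identity modulo \<open>l\<close>
  (\<open>reduction_mod_linear_form\<close>). Homogeneity is expressed by the homomorphism \<open>S \<rightarrow> S[T]\<close> that
  replaces \<open>x_j\<close> by \<open>x_j T\<close>; it sends a homogeneous polynomial \<open>p\<close> of degree \<open>d\<close> to
  \<open>p T^d\<close>, and since a factor of a monomial over a domain is a monomial, factors of homogeneous
  polynomials are homogeneous.
\<close>

section \<open>Substitution homomorphisms\<close>

definition is_ring_hom :: "('a::comm_ring_1 \<Rightarrow> 'b::comm_ring_1) \<Rightarrow> bool" where
  "is_ring_hom h \<longleftrightarrow> h 1 = 1 \<and> (\<forall>x y. h (x + y) = h x + h y) \<and> (\<forall>x y. h (x * y) = h x * h y)"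

lemma is_ring_homD:
  assumes "is_ring_hom h"
  shows "h 0 = 0" "h 1 = 1" "h (x + y) = h x + h y" "h (x * y) = h x * h y"
    "h (- x) = - h x" "h (x - y) = h x - h y"
proof -
  show add: "h (x + y) = h x + h y" for x y using assms by (simp add: is_ring_hom_def)
  show 0: "h 0 = 0" using add[of 0 0] by simp
  show minus: "h (- x) = - h x" for x using add[of x "- x"] 0 by (simp add: minus_unique)
  show "h (x - y) = h x - h y" using add[of x "- y"] minus by simp
qed (use assms in \<open>simp_all add: is_ring_hom_def\<close>)

lemma is_ring_hom_sum:
  assumes "is_ring_hom h"
  shows "h (sum f I) = (\<Sum>i\<in>I. h (f i))"
  by (induction I rule: infinite_finite_induct) (simp_all add: is_ring_homD[OF assms])

lemma is_ring_hom_comp: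
  assumes "is_ring_hom h" "is_ring_hom h'"
  shows "is_ring_hom (\<lambda>p. h (h' p))"
  using assms by (simp add: is_ring_hom_def)

lemma is_ring_hom_id: "is_ring_hom (\<lambda>p. p)"
  by (simp add: is_ring_hom_def)

lemma is_ring_hom_poly: "is_ring_hom (\<lambda>p. poly p u)"
  by (simp add: is_ring_hom_def)

lemma is_ring_hom_const_poly: "is_ring_hom (\<lambda>a. [:a:])"
  by (simp add: is_ring_hom_def flip: one_pCons)

definition poly_subst :: "('a::comm_ring_1 \<Rightarrow> 'b::comm_ring_1) \<Rightarrow> 'b \<Rightarrow> 'a poly \<Rightarrow> 'b" where
  "poly_subst h u p = poly (map_poly h p) u"

lemma poly_subst_0 [simp]: "poly_subst h u 0 = 0"
  by (simp add: poly_subst_def)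

lemma poly_subst_pCons:
  assumes "is_ring_hom h"
  shows "poly_subst h u (pCons a p) = h a + u * poly_subst h u p"
  by (simp add: poly_subst_def Polynomial.map_poly_pCons[where f = h] is_ring_homD[OF assms])

lemma poly_subst_const:
  assumes "is_ring_hom h"
  shows "poly_subst h u [:a:] = h a"
  by (simp add: poly_subst_pCons[OF assms])

lemma poly_subst_X:
  assumes "is_ring_hom h"
  shows "poly_subst h u [:0, 1:] = u"
proof -
  have "poly_subst h u [:0, 1:] = h 0 + u * (h 1 + u * 0)"
    by (simp only: poly_subst_pCons[OF assms] poly_subst_0)
  then show ?thesis by (simp add: is_ring_homD[OF assms])
qed

lemma poly_subst_hom:
  assumes "is_ring_hom h"
  shows "is_ring_hom (poly_subst h u)"
proof -
  note [simp] = poly_subst_pCons[OF assms] is_ring_homD[OF assms]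
  have add: "poly_subst h u (p + q) = poly_subst h u p + poly_subst h u q" for p q
    by (induction p q rule: poly_induct2) (simp_all add: algebra_simps)
  have smult: "poly_subst h u (smult a q) = h a * poly_subst h u q" for a q
    by (induction q) (simp_all add: algebra_simps)
  have "poly_subst h u (p * q) = poly_subst h u p * poly_subst h u q" for p q
    by (induction p) (simp_all add: add smult algebra_simps)
  moreover have "poly_subst h u 1 = 1"
    using poly_subst_const[OF assms, of u 1] by (simp flip: one_pCons)
  ultimately show ?thesis
    by (simp add: is_ring_hom_def add)
qed

lemma hom_eq_poly_subst:
  assumes "is_ring_hom h"
  shows "h p = poly_subst (\<lambda>a. h [:a:]) (h [:0, 1:]) p"
proof (induction p)
  case 0
  then show ?case by (simp add: is_ring_homD[OF assms])
next
  case (pCons a p)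
  have "h (pCons a p) = h ([:a:] + [:0, 1:] * p)" by simp
  also have "\<dots> = h [:a:] + h [:0, 1:] * h p" by (simp only: is_ring_homD[OF assms])
  finally show ?case
    using pCons by (simp add: poly_subst_pCons[OF is_ring_hom_comp[OF assms is_ring_hom_const_poly]])
qed

text \<open>
  The outermost of the three nested polynomial rings is the one in \<open>x3\<close>, so \<open>u $ 3\<close> is
  substituted last.
\<close>

definition subst :: "('k::field \<Rightarrow> 'b::comm_ring_1) \<Rightarrow> 'b^3 \<Rightarrow> 'k S \<Rightarrow> 'b" where
  "subst \<kappa> u = poly_subst (poly_subst (poly_subst \<kappa> (u $ 1)) (u $ 2)) (u $ 3)"

lemma subst_hom:
  assumes "is_ring_hom \<kappa>"
  shows "is_ring_hom (subst \<kappa> u)"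
  unfolding subst_def by (intro poly_subst_hom assms)

lemma subst_const:
  assumes "is_ring_hom \<kappa>"
  shows "subst \<kappa> u (const c) = \<kappa> c"
  by (simp add: subst_def const_def poly_subst_const poly_subst_hom assms)

lemma subst_var:
  assumes "is_ring_hom \<kappa>"
  shows "subst \<kappa> u (var $ j) = u $ j"
proof -
  have "\<forall>j. subst \<kappa> u (var $ j) = u $ j"
    unfolding forall_3 subst_def
    by (simp add: var_def vector_3 poly_subst_const poly_subst_X poly_subst_hom assms del: pCons_one)
  then show ?thesis by blast
qed

lemma const_hom: "is_ring_hom (const :: 'k::field \<Rightarrow> 'k S)"
  by (simp add: is_ring_hom_def const_def flip: one_pCons)

lemma hom_eq_subst:
  fixes h :: "'k::field S \<Rightarrow> 'b::comm_ring_1"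
  assumes "is_ring_hom h"
  shows "h p = subst (\<lambda>c. h (const c)) (\<chi> j. h (var $ j)) p"
proof -
  have 1: "is_ring_hom (\<lambda>a. h [:a:])"
    by (intro is_ring_hom_comp[OF assms] is_ring_hom_const_poly)
  have 2: "is_ring_hom (\<lambda>a. h [:[:a:]:])"
    by (intro is_ring_hom_comp[OF 1] is_ring_hom_const_poly)
  have "h p = poly_subst (poly_subst (poly_subst (\<lambda>a. h [:[:[:a:]:]:]) (h [:[:[:0,1:]:]:])) (h [:[:0,1:]:])) (h [:0,1:]) p"
    unfolding hom_eq_poly_subst[OF 2, symmetric] hom_eq_poly_subst[OF 1, symmetric]
      hom_eq_poly_subst[OF assms, symmetric] ..
  then show ?thesis
    by (simp add: subst_def const_def var_def vector_3)
qed

text \<open>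
  This is the universal property of \<open>S\<close>. All identities between composed substitutions below are
  obtained from it, by comparing values at constants and variables.
\<close>

lemma hom_S_eqI:
  fixes h h' :: "'k::field S \<Rightarrow> 'b::comm_ring_1"
  assumes "is_ring_hom h" "is_ring_hom h'"
    and "\<And>c. h (const c) = h' (const c)" "\<And>j. h (var $ j) = h' (var $ j)"
  shows "h p = h' p"
  using hom_eq_subst[OF assms(1), of p] hom_eq_subst[OF assms(2), of p] assms(3,4) by simp

lemma dvd_poly_subst_diff:
  assumes "is_ring_hom h" "is_ring_hom h'" "\<And>a. l dvd h a - h' a" "l dvd u - u'"
  shows "l dvd poly_subst h u p - poly_subst h' u' p"
proof (induction p)
  case 0
  then show ?case by (simp add: poly_subst_def)
next
  case (pCons a p)
  have *: "h a + u * poly_subst h u p - (h' a + u' * poly_subst h' u' p)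
      = (h a - h' a) + (u - u') * poly_subst h u p + u' * (poly_subst h u p - poly_subst h' u' p)"
    by (simp add: algebra_simps)
  show ?case
    unfolding poly_subst_pCons[OF assms(1)] poly_subst_pCons[OF assms(2)] *
    by (intro dvd_add dvd_mult dvd_mult2 assms pCons.IH)
qed

lemma dvd_subst_diff:
  assumes "is_ring_hom \<kappa>" "\<And>j. l dvd u $ j - u' $ j"
  shows "l dvd subst \<kappa> u p - subst \<kappa> u' p"
  unfolding subst_def
  by (intro dvd_poly_subst_diff poly_subst_hom assms) simp

section \<open>Homogeneous polynomials\<close>

text \<open>
  The new variable \<open>T\<close> records the total degree: the coefficient of \<open>T^d\<close> in \<open>grade p\<close> is the
  homogeneous component of degree \<open>d\<close> of \<open>p\<close>.
\<close>

definition grade :: "'k::field S \<Rightarrow> 'k S poly" where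
  "grade = subst (\<lambda>c. [:const c:]) (\<chi> j. monom (var $ j) 1)"

text \<open>
  Unlike membership in \<open>S_deg d\<close>, this condition is an equation between values of a ring
  homomorphism, so its behaviour under products, factors and graded endomorphisms follows formally.
\<close>

definition homogeneous :: "nat \<Rightarrow> 'k::field S \<Rightarrow> bool" where
  "homogeneous d p \<longleftrightarrow> grade p = monom p d"

lemma const_poly_hom: "is_ring_hom (\<lambda>c. [:const c:])"
  using is_ring_hom_comp[OF is_ring_hom_const_poly const_hom] .

lemma grade_hom: "is_ring_hom grade"
  unfolding grade_def by (intro subst_hom const_poly_hom)

lemma grade_const: "grade (const c) = [:const c:]"
  by (simp add: grade_def subst_const const_poly_hom)

lemma grade_var: "grade (var $ j) = monom (var $ j) 1"
  by (simp add: grade_def subst_var const_poly_hom)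

lemma grade_at_1: "poly (grade p) 1 = p"
  using hom_S_eqI[OF is_ring_hom_comp[OF is_ring_hom_poly[of 1] grade_hom] is_ring_hom_id, of p]
  by (simp add: grade_const grade_var poly_monom)

lemma subst_id: "subst const var p = (p :: 'k::field S)"
  using hom_S_eqI[OF subst_hom[OF const_hom, of var] is_ring_hom_id, of p]
  by (simp add: subst_const subst_var const_hom)

lemma poly_subst_altdef:
  assumes "is_ring_hom h"
  shows "poly_subst h u p = (\<Sum>i\<le>degree p. h (coeff p i) * u ^ i)"
proof -
  have "degree (map_poly h p) \<le> degree p" by (rule degree_map_poly_le)
  then have "poly (map_poly h p) u = (\<Sum>i\<le>degree p. coeff (map_poly h p) i * u ^ i)"
    unfolding poly_altdef by (intro sum.mono_neutral_left) (auto simp: coeff_eq_0)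
  then show ?thesis
    by (simp add: poly_subst_def coeff_map_poly is_ring_homD[OF assms])
qed

lemma mcoeff_0: "mcoeff p 0 0 0 = poly (poly (poly p 0) 0) 0"
  by (simp add: mcoeff_def poly_0_coeff_0)

lemma var_at_0: "poly (poly (poly (var $ j) 0) 0) 0 = 0"
proof -
  have "\<forall>j. poly (poly (poly (var $ j) 0) 0) 0 = 0"
    unfolding forall_3 by (simp add: var_def vector_3)
  then show ?thesis by blast
qed

lemma const_at_0: "poly (poly (poly (const c) 0) 0) 0 = c"
  by (simp add: const_def)

lemma is_ring_hom_at_0: "is_ring_hom (\<lambda>p. poly (poly (poly p 0) 0) 0)"
  by (simp add: is_ring_hom_def)

lemma grade_at_0: "poly (grade p) 0 = const (mcoeff p 0 0 0)"
  unfolding mcoeff_0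
  by (rule hom_S_eqI[OF is_ring_hom_comp[OF is_ring_hom_poly grade_hom] is_ring_hom_comp[OF const_hom is_ring_hom_at_0]])
    (simp_all add: grade_const grade_var poly_monom var_at_0 const_at_0, simp add: const_def)

lemma S_deg_homogeneous:
  fixes p :: "'k::field S"
  assumes "p \<in> S_deg d"
  shows "homogeneous d p"
proof -
  have h1: "is_ring_hom (poly_subst const (var $ 1 :: 'k S))"
    by (intro poly_subst_hom const_hom)
  have h2: "is_ring_hom (poly_subst (poly_subst const (var $ 1 :: 'k S)) (var $ 2))"
    by (intro poly_subst_hom const_hom)
  have h3: "is_ring_hom (poly_subst (\<lambda>c :: 'k. [:const c:]) (monom (var $ 1) 1))"
    by (intro poly_subst_hom const_poly_hom)
  have h4: "is_ring_hom (poly_subst (poly_subst (\<lambda>c :: 'k. [:const c:]) (monom (var $ 1) 1)) (monom (var $ 2) 1))"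
    by (intro poly_subst_hom const_poly_hom)
  (* Expand p into monomials; the exponents of T add up to d in each monomial that occurs. *)
  let ?m = "\<lambda>k j i. const (mcoeff p i j k) * var $ 1 ^ i * var $ 2 ^ j * var $ 3 ^ k"
  have p: "p = (\<Sum>k\<le>degree p. \<Sum>j\<le>degree (coeff p k). \<Sum>i\<le>degree (coeff (coeff p k) j). ?m k j i)"
    using subst_id[of p, symmetric]
    by (simp add: subst_def poly_subst_altdef[OF h2] poly_subst_altdef[OF h1]
        poly_subst_altdef[OF const_hom] sum_distrib_right mcoeff_def)
  have m: "[:const (mcoeff p i j k):] * monom (var $ 1) 1 ^ i * monom (var $ 2) 1 ^ j * monom (var $ 3) 1 ^ k
      = monom (?m k j i) d" for i j k
  proof (cases "mcoeff p i j k = 0")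
    case True
    then show ?thesis by (simp add: const_def)
  next
    case False
    then have "i + j + k = d" using assms by (auto simp: S_deg_def)
    then show ?thesis
      by (auto simp: monom_power mult_monom monom_0[symmetric])
  qed
  have "grade p = (\<Sum>k\<le>degree p. \<Sum>j\<le>degree (coeff p k). \<Sum>i\<le>degree (coeff (coeff p k) j). monom (?m k j i) d)"
    unfolding m[symmetric]
    unfolding grade_def subst_def vec_lambda_beta poly_subst_altdef[OF h4] poly_subst_altdef[OF h3]
      poly_subst_altdef[OF const_poly_hom] sum_distrib_right mcoeff_def ..
  also have "\<dots> = monom p d"
    using arg_cong[OF p, of "\<lambda>q. monom q d"] unfolding monom_sum by (rule sym)
  finally show ?thesis by (simp add: homogeneous_def)
qed

lemma homogeneous_1: "homogeneous 0 1"
  by (simp add: homogeneous_def is_ring_homD[OF grade_hom])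

lemma homogeneous_mult: "homogeneous d p \<Longrightarrow> homogeneous e q \<Longrightarrow> homogeneous (d + e) (p * q)"
  by (simp add: homogeneous_def is_ring_homD[OF grade_hom] mult_monom)

lemma homogeneous_add: "homogeneous d p \<Longrightarrow> homogeneous d q \<Longrightarrow> homogeneous d (p + q)"
  by (simp add: homogeneous_def is_ring_homD[OF grade_hom] add_monom)

lemma homogeneous_diff: "homogeneous d p \<Longrightarrow> homogeneous d q \<Longrightarrow> homogeneous d (p - q)"
  by (simp add: homogeneous_def is_ring_homD[OF grade_hom] diff_monom)

lemma homogeneous_uminus_iff: "homogeneous d (- p) \<longleftrightarrow> homogeneous d p"
  by (simp add: homogeneous_def is_ring_homD[OF grade_hom] flip: minus_monom)

text \<open>
  If the constant coefficient of \<open>a b\<close> vanishes, then that of \<open>a\<close> or of \<open>b\<close> does, and one factor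
  \<open>T\<close> can be removed there.
\<close>

lemma monom_factor:
  fixes a b :: "'a::idom poly"
  assumes "a * b = monom c n" "c \<noteq> 0"
  shows "\<exists>c' k. a = monom c' k"
  using assms
proof (induction n arbitrary: a b)
  case 0
  then have "a \<noteq> 0" "b \<noteq> 0" by auto
  with 0 have "degree a + degree b = 0"
    by (metis degree_monom_eq degree_mult_eq)
  then have "a = monom (coeff a 0) 0"
    by (simp add: monom_0 degree_0_id)
  then show ?case by blast
next
  case (Suc n)
  have "coeff a 0 * coeff b 0 = 0"
    using arg_cong[OF Suc.prems(1), of "\<lambda>p. coeff p 0"] by (simp add: coeff_mult_0)
  then consider a' where "a = pCons 0 a'" | b' where "b = pCons 0 b'"
    by (metis coeff_pCons_0 mult_eq_0_iff pCons_cases)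
  then show ?case
  proof cases
    case 1
    with Suc.prems have "a' * b = monom c n" by (simp add: monom_Suc)
    from Suc.IH[OF this Suc.prems(2)] obtain c' k where "a' = monom c' k" by blast
    with 1 have "a = monom c' (Suc k)" by (simp add: monom_Suc)
    then show ?thesis by blast
  next
    case 2
    with Suc.prems have "a * b' = monom c n" by (simp add: monom_Suc)
    from Suc.IH[OF this Suc.prems(2)] show ?thesis .
  qed
qed

text \<open>
  A factor of \<open>p q T^d\<close> in \<open>S[T]\<close> is a monomial \<open>c T^k\<close>, and \<open>T = 1\<close> identifies \<open>c\<close>.
\<close>

lemma homogeneous_factor:
  fixes p q :: "'k::field S"
  assumes "homogeneous d (p * q)" "p * q \<noteq> 0"
  shows "\<exists>k. homogeneous k p"
proof -
  obtain c k where c: "grade p = monom c k"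
    using monom_factor[of "grade p" "grade q" "p * q" d] assms
    by (auto simp: homogeneous_def is_ring_homD[OF grade_hom])
  then have "c = p" using grade_at_1[of p] by (simp add: poly_monom)
  with c show ?thesis by (auto simp: homogeneous_def)
qed

text \<open>
  Setting \<open>T = 0\<close> in \<open>grade p = p T^k\<close> gives the constant term of \<open>p\<close>, so it can be nonzero only if
  \<open>k = 0\<close>.
\<close>

lemma homogeneous_const_term:
  assumes "homogeneous k p" "mcoeff p 0 0 0 \<noteq> 0"
  shows "p = const (mcoeff p 0 0 0)"
proof -
  have "const (mcoeff p 0 0 0) = poly (monom p k) 0"
    using assms grade_at_0[of p] by (simp add: homogeneous_def)
  with assms(2) have "k = 0"
    by (cases k) (auto simp: const_def poly_monom)
  with assms grade_at_0[of p] show ?thesis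
    by (simp add: homogeneous_def poly_monom)
qed

lemma const_unit: "c \<noteq> 0 \<Longrightarrow> const c dvd 1"
proof -
  assume "c \<noteq> 0"
  then have "const c * const (inverse c) = 1"
    by (simp add: const_def flip: one_pCons)
  then show ?thesis by (metis dvd_triv_left)
qed

lemma unit_is_const:
  fixes c :: "'k::field S"
  assumes "c dvd 1"
  obtains k where "k \<noteq> 0" "c = const k"
proof -
  from assms obtain e where e: "1 = c * e" by (elim dvdE)
  obtain d where "homogeneous d c" using homogeneous_factor[of 0 c e] e homogeneous_1 by (metis one_neq_zero)
  moreover have "mcoeff c 0 0 0 * mcoeff e 0 0 0 = 1"
    using arg_cong[OF e, of "\<lambda>p. mcoeff p 0 0 0"] by (simp add: mcoeff_0)
  then have nz: "mcoeff c 0 0 0 \<noteq> 0" by auto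
  ultimately show thesis using that[OF nz] homogeneous_const_term by blast
qed

lemma S_pos_iff: "p \<in> S_pos \<longleftrightarrow> mcoeff p 0 0 0 = 0"
  by (auto simp: S_pos_def Suc_le_eq intro: Nat.gr0I)

lemma homogeneous_unit_or_S_pos:
  assumes "homogeneous k p" "p \<notin> S_pos"
  shows "p dvd 1"
  using homogeneous_const_term[OF assms(1)] assms(2) const_unit S_pos_iff by metis

section \<open>Linear forms\<close>

lemma S_eqI:
  assumes "\<And>i j k. mcoeff p i j k = mcoeff q i j k"
  shows "p = q"
  using assms by (intro poly_eqI) (simp add: mcoeff_def)

lemma linear_form_explicit:
  "linear_form a = [:[:[:0, a $ 1:], [:a $ 2:]:], [:[:a $ 3:]:]:]"
  by (simp add: linear_form_def sum_3 const_def var_def vector_3)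

lemma mcoeff_linear_form:
  "mcoeff (linear_form a) i j k =
    (if i = 1 \<and> j = 0 \<and> k = 0 then a $ 1 else if i = 0 \<and> j = 1 \<and> k = 0 then a $ 2
     else if i = 0 \<and> j = 0 \<and> k = 1 then a $ 3 else 0)"
  by (simp add: mcoeff_def linear_form_explicit coeff_pCons split: nat.splits)

lemma linear_form_in_S_deg: "linear_form a \<in> S_deg 1"
  by (simp add: S_deg_def mcoeff_linear_form)

lemma S_deg_1_cases:
  assumes "p \<in> S_deg 1"
  obtains a where "p = linear_form a"
proof
  show "p = linear_form (vector [mcoeff p 1 0 0, mcoeff p 0 1 0, mcoeff p 0 0 1])"
  proof (rule S_eqI)
    fix i j k
    show "mcoeff p i j k = mcoeff (linear_form (vector [mcoeff p 1 0 0, mcoeff p 0 1 0, mcoeff p 0 0 1])) i j k"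
    proof (cases "i + j + k = 1")
      case True
      then have "i = 1 \<and> j = 0 \<and> k = 0 \<or> i = 0 \<and> j = 1 \<and> k = 0 \<or> i = 0 \<and> j = 0 \<and> k = 1"
        by presburger
      then show ?thesis by (auto simp: mcoeff_linear_form vector_3)
    next
      case False
      then have "mcoeff p i j k = 0" using assms by (auto simp: S_deg_def)
      with False show ?thesis by (auto simp: mcoeff_linear_form)
    qed
  qed
qed

lemma linear_form_eq_0_iff: "linear_form a = 0 \<longleftrightarrow> a = 0"
  by (auto simp: linear_form_explicit Finite_Cartesian_Product.vec_eq_iff forall_3)

lemma der_apply_linear_form: "der_apply \<theta> (linear_form a) = (\<Sum>i\<in>UNIV. const (a $ i) * \<theta> $ i)"
proof -
  have "partial (linear_form a) $ i = const (a $ i)" for i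
  proof -
    have "\<forall>i. partial (linear_form a) $ i = const (a $ i)"
      unfolding forall_3
      by (simp add: partial_def linear_form_explicit const_def vector_3 pderiv_pCons Polynomial.map_poly_pCons[where f = pderiv]
         Polynomial.map_poly_pCons[where f = "map_poly pderiv"])
    then show ?thesis by blast
  qed
  then show ?thesis by (simp add: der_apply_def mult.commute)
qed

lemma hom_linear_form:
  assumes "is_ring_hom h"
  shows "h (linear_form a) = (\<Sum>i\<in>UNIV. h (const (a $ i)) * h (var $ i))"
  by (simp add: linear_form_def is_ring_hom_sum[OF assms] is_ring_homD[OF assms])

text \<open>
  With \<open>\<Sum> a_j b_j = 1\<close>, the substitution \<open>x_j \<mapsto> x_j - b_j l\<close> sends \<open>l = \<Sum> a_j x_j\<close> to
  \<open>l - (\<Sum> a_j b_j) l = 0\<close>, and it does not change polynomials modulo \<open>l\<close>. It is therefore a model of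
  the quotient map \<open>S \<rightarrow> S/(l)\<close> whose values lie in the factorial domain \<open>S\<close>; it respects degrees
  because \<open>x_j - b_j l\<close> is again a linear form.
\<close>

lemma reduction_mod_linear_form:
  fixes a :: "'k::field^3"
  assumes "a \<noteq> 0"
  obtains \<pi> :: "'k S \<Rightarrow> 'k S" where "is_ring_hom \<pi>" "\<And>p. \<pi> p = 0 \<longleftrightarrow> linear_form a dvd p"
    "\<And>p. linear_form a dvd p - \<pi> p" "\<And>d p. homogeneous d p \<Longrightarrow> homogeneous d (\<pi> p)"
proof -
  from assms have "\<exists>k. a $ k \<noteq> 0" by (simp add: Finite_Cartesian_Product.vec_eq_iff)
  then obtain k where k: "a $ k \<noteq> 0" by blast
  define l where "l = linear_form a"
  define b where "b = (\<lambda>j. if j = k then inverse (a $ k) else 0)"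
  have ab: "(\<Sum>i\<in>UNIV. a $ i * b i) = 1"
    using k by (simp add: b_def if_distrib sum.delta cong: if_cong)
  define u where "u = (\<chi> j. var $ j - const (b j) * l)"
  define \<pi> where "\<pi> = subst const u"
  have hom: "is_ring_hom \<pi>" unfolding \<pi>_def by (intro subst_hom const_hom)
  have \<pi>_const: "\<pi> (const c) = const c" for c by (simp add: \<pi>_def subst_const const_hom)
  have \<pi>_var: "\<pi> (var $ j) = u $ j" for j by (simp add: \<pi>_def subst_var const_hom)
  have "\<pi> l = (\<Sum>i\<in>UNIV. const (a $ i) * u $ i)"
    by (simp add: l_def hom_linear_form[OF hom] \<pi>_const \<pi>_var)
  also have "\<dots> = l - (\<Sum>i\<in>UNIV. const (a $ i) * const (b i)) * l"
    by (simp add: u_def right_diff_distrib sum_subtractf linear_form_def[of a, folded l_def]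
        sum_distrib_right mult.assoc)
  also have "(\<Sum>i\<in>UNIV. const (a $ i) * const (b i)) = const 1"
    by (simp flip: ab add: is_ring_hom_sum[OF const_hom] is_ring_homD[OF const_hom])
  finally have \<pi>l: "\<pi> l = 0" by (simp add: is_ring_homD[OF const_hom])
  have "l dvd subst const var p - subst const u p" for p
    by (rule dvd_subst_diff[OF const_hom]) (simp add: u_def)
  then have cong: "l dvd p - \<pi> p" for p by (simp add: subst_id \<pi>_def)
  have ker: "\<pi> p = 0 \<longleftrightarrow> l dvd p" for p
    using cong[of p] \<pi>l by (auto simp: is_ring_homD[OF hom] elim: dvdE)
  have graded: "homogeneous d (\<pi> p)" if "homogeneous d p" for d p
  proof -
    have hom': "is_ring_hom (\<lambda>p. [:\<pi> p:])"
      by (intro is_ring_hom_comp[OF is_ring_hom_const_poly hom])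
    have l: "grade l = monom l 1"
      using S_deg_homogeneous[OF linear_form_in_S_deg, of a] by (simp add: l_def homogeneous_def)
    (* Applying \<pi> to the coefficients of polynomials in T is a homomorphism S[T] \<rightarrow> S[T] that carries
       grade p to grade (\<pi> p). *)
    define T :: "'k S poly" where "T = [:0, 1:]"
    have T: "poly_subst (\<lambda>p. [:\<pi> p:]) T (monom q n) = monom (\<pi> q) n" for q n
      by (induction n)
        (simp_all add: T_def monom_0 monom_Suc poly_subst_const[OF hom'] poly_subst_pCons[OF hom']
          is_ring_homD[OF hom])
    have "grade (u $ j) = monom (u $ j) 1" for j
      by (simp add: u_def is_ring_homD[OF grade_hom] grade_var grade_const l smult_monom diff_monom)
    then have "grade (\<pi> p) = poly_subst (\<lambda>p. [:\<pi> p:]) T (grade p)"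
      using hom_S_eqI[OF is_ring_hom_comp[OF grade_hom hom] is_ring_hom_comp[OF poly_subst_hom[OF hom'] grade_hom], of T p]
      by (simp add: \<pi>_const \<pi>_var grade_const grade_var poly_subst_const[OF hom'] T)
    also have "\<dots> = monom (\<pi> p) d"
      using that by (simp add: homogeneous_def T)
    finally show ?thesis by (simp add: homogeneous_def)
  qed
  show thesis
    using that[of \<pi>] hom ker cong graded by (simp add: l_def)
qed

text \<open>
  The ideal of \<open>l\<close> is the kernel of a homomorphism into a domain.
\<close>

lemma prime_elem_linear_form:
  assumes "a \<noteq> 0"
  shows "prime_elem (linear_form a)"
proof -
  obtain \<pi> :: "'a S \<Rightarrow> 'a S" where \<pi>: "is_ring_hom \<pi>" "\<And>p. \<pi> p = 0 \<longleftrightarrow> linear_form a dvd p"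
    using reduction_mod_linear_form[OF assms] by metis
  have "\<not> linear_form a dvd 1"
    using \<pi>(2)[of 1] by (simp add: is_ring_homD[OF \<pi>(1)])
  moreover have "linear_form a dvd p \<or> linear_form a dvd q" if "linear_form a dvd p * q" for p q
    using that \<pi>(2)[of "p * q"] \<pi>(2)[of p] \<pi>(2)[of q] by (auto simp: is_ring_homD[OF \<pi>(1)])
  ultimately show ?thesis
    unfolding prime_elem_def using assms by (auto simp: linear_form_eq_0_iff)
qed

section \<open>Proportional families modulo a linear form\<close>

text \<open>
  Two proportional families in a factorial domain are multiples of one family \<open>v\<close>. The proof avoids
  greatest common divisors by removing the prime factors \<open>f\<close> of \<open>P i\<close> one at a time. If \<open>f\<close> divides
  all \<open>P j\<close>, it is moved into \<open>d\<close>. Otherwise \<open>f\<close> divides \<open>C i\<close>, and it can be cancelled from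
  \<open>P i\<close> and \<open>C i\<close> alone, because every hypothesis \<open>C i * P j = C j * P i\<close> with \<open>j \<noteq> i\<close>
  is linear in the pair \<open>(P i, C i)\<close>; the factor \<open>f\<close> is then restored in \<open>v i\<close>.
\<close>

lemma proportional_common_factor:
  fixes P C :: "'i \<Rightarrow> 'a::ufd"
  assumes "P i \<noteq> 0" "\<And>j. j \<in> I \<Longrightarrow> C i * P j = C j * P i" "i \<in> I"
  shows "\<exists>d v t. \<forall>j\<in>I. P j = d * v j \<and> C j = t * v j"
proof -
  (* In both auxiliary claims p and c stand for the current values at the index i, which change
     independently of the values at the other indices. *)
  have unit_case: "\<exists>d v t. (p = d * v i \<and> c = t * v i) \<and> (\<forall>j\<in>I-{i}. P j = d * v j \<and> C j = t * v j)"
    if "p dvd 1" "\<And>j. j \<in> I - {i} \<Longrightarrow> c * P j = C j * p" for p c :: 'a and P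
  proof -
    from that(1) obtain q where q: "1 = p * q" by (elim dvdE)
    have "C j = c * q * P j" if "j \<in> I - {i}" for j
    proof -
      have "C j = (C j * p) * q" using q by (simp add: mult.assoc)
      also have "\<dots> = c * q * P j"
        unfolding \<open>\<And>j. j \<in> I - {i} \<Longrightarrow> c * P j = C j * p\<close>[OF that, symmetric] by (simp add: mult_ac)
      finally show ?thesis .
    qed
    moreover have "c = c * q * p" using q by (simp add: mult.assoc mult.commute)
    ultimately show ?thesis
      by (intro exI[of _ 1] exI[of _ "P(i := p)"] exI[of _ "c * q"]) simp
  qed
  have "\<exists>d v t. (prod_mset F = d * v i \<and> c = t * v i) \<and> (\<forall>j\<in>I-{i}. P j = d * v j \<and> C j = t * v j)"
    if "\<And>f. f \<in># F \<Longrightarrow> prime_elem f" "\<And>j. j \<in> I - {i} \<Longrightarrow> c * P j = C j * prod_mset F" for F c and P :: "'i \<Rightarrow> 'a"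
    using that
  proof (induction F arbitrary: P c)
    case empty
    then show ?case by (intro unit_case) simp_all
  next
    case (add f F)
    have f: "prime_elem f" using add.prems by simp
    show ?case
    proof (cases "\<forall>j\<in>I-{i}. f dvd P j")
      case True
      then have "\<forall>j. \<exists>P'. j \<in> I - {i} \<longrightarrow> P j = f * P'" by (auto simp: dvd_def)
      then obtain P' where P': "\<And>j. j \<in> I - {i} \<Longrightarrow> P j = f * P' j" by metis
      have "c * P' j = C j * prod_mset F" if "j \<in> I - {i}" for j
      proof -
        have "f * (c * P' j) = f * (C j * prod_mset F)"
          using add.prems(2)[OF that] P'[OF that] by (simp add: mult.left_commute)
        then show ?thesis using f by auto
      qed
      from add.IH[OF _ this] add.prems obtain d v t where
        "prod_mset F = d * v i" "c = t * v i" "\<forall>j\<in>I-{i}. P' j = d * v j \<and> C j = t * v j"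
        by auto
      then show ?thesis using P'
        by (intro exI[of _ "f * d"] exI[of _ v] exI[of _ t]) (simp add: mult.assoc)
    next
      case False
      then obtain k where k: "k \<in> I - {i}" "\<not> f dvd P k" by blast
      have "f dvd c * P k" using add.prems(2)[OF k(1)] by simp
      with f k have "f dvd c" by (simp add: prime_elem_dvd_mult_iff)
      then obtain c' where c': "c = f * c'" by (elim dvdE)
      have "c' * P j = C j * prod_mset F" if "j \<in> I - {i}" for j
      proof -
        have "f * (c' * P j) = f * (C j * prod_mset F)"
          using add.prems(2)[OF that] c' by (simp add: ac_simps)
        then show ?thesis using f by auto
      qed
      from add.IH[OF _ this] add.prems obtain d v t where
        "prod_mset F = d * v i" "c' = t * v i" "\<forall>j\<in>I-{i}. P j = d * v j \<and> C j = t * v j"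
        by auto
      then show ?thesis using c'
        by (intro exI[of _ d] exI[of _ "v(i := f * v i)"] exI[of _ t]) (simp add: ac_simps)
    qed
  qed
  note prime_case = this
  have "\<exists>d v t. (P i = d * v i \<and> C i = t * v i) \<and> (\<forall>j\<in>I-{i}. P j = d * v j \<and> C j = t * v j)"
  proof (cases "P i dvd 1")
    case True
    then show ?thesis using assms by (intro unit_case) auto
  next
    case False
    then obtain F where F: "mset_factors F (P i)" using mset_factors_exist assms(1) by blast
    then have "P i = prod_mset F" "\<And>f. f \<in># F \<Longrightarrow> prime_elem f"
      by (auto simp: mset_factors_def)
    then show ?thesis using prime_case[of F "C i" P] assms by auto
  qed
  then show ?thesis using assms(3) by (metis DiffI singletonD)
qed

text \<open>
  The form \<open>l\<close> itself counts as a common divisor modulo \<open>l\<close> of a family of multiples of \<open>l\<close>.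
\<close>

lemma no_common_divisor_mod_imp_not_all_dvd:
  assumes "\<nexists>h. common_divisor_mod h (g ` I) l" "l \<in> S_pos"
  shows "\<exists>i\<in>I. \<not> l dvd g i"
proof (rule ccontr)
  assume "\<not> ?thesis"
  then have "common_divisor_mod l (g ` I) l"
    using assms(2) by (fastforce simp: common_divisor_mod_def dvd_def mult.commute intro: exI[of _ 0])
  with assms(1) show False by blast
qed

text \<open>
  After reduction modulo \<open>l\<close> the families are multiples \<open>t v\<close> and \<open>d v\<close> of one family. The common
  factor \<open>d\<close> of the reduced \<open>g i\<close> is homogeneous, so it is either a unit or has no constant
  term; in the latter case it would be a common divisor modulo \<open>l\<close>.
\<close>

lemma proportional_mod_linear_form:
  fixes c g :: "'i \<Rightarrow> 'k::field S"
  assumes "a \<noteq> 0" and l_def: "l = linear_form a"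
    and homog: "\<And>i. i \<in> I \<Longrightarrow> \<exists>d. homogeneous d (g i)"
    and no_div: "\<nexists>h. common_divisor_mod h (g ` I) l"
    and proportional: "\<And>i j. i \<in> I \<Longrightarrow> j \<in> I \<Longrightarrow> l dvd c i * g j - c j * g i"
  shows "\<exists>t. \<forall>i\<in>I. l dvd c i - t * g i"
proof -
  obtain \<pi> :: "'k S \<Rightarrow> 'k S" where hom: "is_ring_hom \<pi>" and ker: "\<And>p. \<pi> p = 0 \<longleftrightarrow> l dvd p"
    and cong: "\<And>p. l dvd p - \<pi> p" and graded: "\<And>d p. homogeneous d p \<Longrightarrow> homogeneous d (\<pi> p)"
    using reduction_mod_linear_form[OF assms(1)] unfolding l_def by metis
  have "l \<in> S_pos" using linear_form_in_S_deg[of a] by (auto simp: l_def S_pos_def S_deg_def)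
  with no_div obtain i where i: "i \<in> I" "\<pi> (g i) \<noteq> 0"
    using no_common_divisor_mod_imp_not_all_dvd ker by metis
  have "\<pi> (c i) * \<pi> (g j) = \<pi> (c j) * \<pi> (g i)" if "j \<in> I" for j
    using proportional[OF i(1) that] ker[of "c i * g j - c j * g i"] by (simp add: is_ring_homD[OF hom])
  from proportional_common_factor[of "\<lambda>j. \<pi> (g j)" i I "\<lambda>j. \<pi> (c j)", OF i(2) this i(1)]
  obtain d v t where d: "\<And>j. j \<in> I \<Longrightarrow> \<pi> (g j) = d * v j" and t: "\<And>j. j \<in> I \<Longrightarrow> \<pi> (c j) = t * v j"
    by metis
  obtain k where "homogeneous k d"
    using homogeneous_factor[of _ d "v i"] homog[OF i(1)] graded d[OF i(1)] i(2) by metis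
  moreover have "d \<notin> S_pos"
  proof
    assume "d \<in> S_pos"
    moreover have "\<exists>x y. g j = x * d + y * l" if "j \<in> I" for j
    proof -
      from cong[of "g j"] obtain y where "g j - \<pi> (g j) = l * y" by (elim dvdE)
      then have "g j = v j * d + y * l" using d[OF that] by (simp add: algebra_simps)
      then show ?thesis by blast
    qed
    ultimately have "common_divisor_mod d (g ` I) l" by (auto simp: common_divisor_mod_def)
    with no_div show False by blast
  qed
  ultimately have "d dvd 1" by (rule homogeneous_unit_or_S_pos)
  then obtain e where e: "1 = d * e" by (elim dvdE)
  have "l dvd c j - (t * e) * g j" if "j \<in> I" for j
  proof -
    have "\<pi> (c j) = t * (d * e) * v j" using t[OF that] e by simp
    then have "\<pi> (c j) = (t * e) * \<pi> (g j)" using d[OF that] by (simp add: mult_ac)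
    then have "c j - (t * e) * g j = (c j - \<pi> (c j)) - (t * e) * (g j - \<pi> (g j))"
      by (simp add: algebra_simps)
    then show ?thesis using cong by (metis dvd_diff dvd_mult)
  qed
  then show ?thesis by blast
qed

section \<open>Logarithmic derivations and their determinants\<close>

abbreviation det_rows :: "'a::comm_ring_1^3 \<Rightarrow> 'a^3 \<Rightarrow> 'a^3 \<Rightarrow> 'a" where
  "det_rows u v w \<equiv> det (vector [u, v, w] :: 'a^3^3)"

lemma det_rows_expand:
  "det_rows u v w = u $ 1 * v $ 2 * w $ 3 + u $ 2 * v $ 3 * w $ 1 + u $ 3 * v $ 1 * w $ 2
     - u $ 1 * v $ 3 * w $ 2 - u $ 2 * v $ 1 * w $ 3 - u $ 3 * v $ 2 * w $ 1"
  by (simp add: det_3 vector_3)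

lemma cramer_relation:
  "det_rows v w z *s u - det_rows u w z *s v + det_rows u v z *s w - det_rows u v w *s z = 0"
  unfolding Finite_Cartesian_Product.vec_eq_iff forall_3
  by (simp add: det_rows_expand algebra_simps)

text \<open>
  This is the three-term Pluecker relation for the minors containing \<open>w\<close>; modulo \<open>w\<close> it is the
  relation between the six minors of four vectors in a plane.
\<close>

lemma pluecker_relation:
  "det_rows u v w * det_rows x y w - det_rows u x w * det_rows v y w + det_rows u y w * det_rows v x w = 0"
  unfolding det_rows_expand by (simp add: algebra_simps)

lemma delete_row_simps:
  "delete_row \<theta> 1 = vector [\<theta> 2, \<theta> 3, \<theta> 4]" "delete_row \<theta> 2 = vector [\<theta> 1, \<theta> 3, \<theta> 4]"
  "delete_row \<theta> 3 = vector [\<theta> 1, \<theta> 2, \<theta> 4]" "delete_row \<theta> 4 = vector [\<theta> 1, \<theta> 2, \<theta> 3]"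
proof -
  have "[1..<5] = [1, 2, 3, 4 :: nat]" by (simp add: upt_rec)
  then show "delete_row \<theta> 1 = vector [\<theta> 2, \<theta> 3, \<theta> 4]" "delete_row \<theta> 2 = vector [\<theta> 1, \<theta> 3, \<theta> 4]"
    "delete_row \<theta> 3 = vector [\<theta> 1, \<theta> 2, \<theta> 4]" "delete_row \<theta> 4 = vector [\<theta> 1, \<theta> 2, \<theta> 3]"
    by (simp_all add: delete_row_def)
qed

text \<open>
  Multiplying column \<open>k\<close> by \<open>a $ k\<close> and adding multiples of the other columns turns it into the column
  of the values of \<open>u\<close>, \<open>v\<close>, \<open>w\<close> at the linear form, all of which are divisible by it. Some
  \<open>a $ k\<close> is a unit.
\<close>

lemma linear_form_dvd_det:
  fixes u v w :: "'k::field der"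
  assumes "a \<noteq> 0" "\<And>z. z \<in> {u, v, w} \<Longrightarrow> linear_form a dvd der_apply z (linear_form a)"
  shows "linear_form a dvd det_rows u v w"
proof -
  let ?l = "linear_form a"
  have dvd: "?l dvd const (a $ 1) * z $ 1 + const (a $ 2) * z $ 2 + const (a $ 3) * z $ 3" if "z \<in> {u, v, w}" for z
    using assms(2)[OF that] by (simp add: der_apply_linear_form sum_3)
  let ?\<phi> = "\<lambda>z. const (a $ 1) * z $ 1 + const (a $ 2) * z $ 2 + const (a $ 3) * z $ 3"
  have dvd3: "?l dvd ?\<phi> u * p + ?\<phi> v * q + ?\<phi> w * r" for p q r
    by (intro dvd_add dvd_mult2 dvd) simp_all
  have "const (a $ 1) * det_rows u v w = ?\<phi> u * (v $ 2 * w $ 3 - v $ 3 * w $ 2)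
      + ?\<phi> v * (u $ 3 * w $ 2 - u $ 2 * w $ 3) + ?\<phi> w * (u $ 2 * v $ 3 - u $ 3 * v $ 2)"
    unfolding det_rows_expand by (simp add: algebra_simps)
  moreover have "const (a $ 2) * det_rows u v w = ?\<phi> u * (v $ 3 * w $ 1 - v $ 1 * w $ 3)
      + ?\<phi> v * (u $ 1 * w $ 3 - u $ 3 * w $ 1) + ?\<phi> w * (u $ 3 * v $ 1 - u $ 1 * v $ 3)"
    unfolding det_rows_expand by (simp add: algebra_simps)
  moreover have "const (a $ 3) * det_rows u v w = ?\<phi> u * (v $ 1 * w $ 2 - v $ 2 * w $ 1)
      + ?\<phi> v * (u $ 2 * w $ 1 - u $ 1 * w $ 2) + ?\<phi> w * (u $ 1 * v $ 2 - u $ 2 * v $ 1)"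
    unfolding det_rows_expand by (simp add: algebra_simps)
  ultimately have *: "\<forall>k. ?l dvd const (a $ k) * det_rows u v w"
    unfolding forall_3 by (simp only: dvd3 simp_thms)
  from assms(1) have "\<exists>k. a $ k \<noteq> 0" by (simp add: Finite_Cartesian_Product.vec_eq_iff)
  then obtain k where "const (a $ k) dvd 1" using const_unit by blast
  with * show ?thesis by (metis dvd_mult_unit_iff')
qed

lemma prime_elem_dvd_prod:
  assumes "prime_elem p" "finite I" "p dvd prod f I"
  shows "\<exists>i\<in>I. p dvd f i"
  using assms(2,3)
proof (induction I rule: finite_induct)
  case empty
  then show ?case using assms(1) by (simp add: prime_elem_def)
next
  case (insert i I)
  then show ?case using assms(1) by (auto simp: prime_elem_dvd_mult_iff)
qed

lemma prod_primes_dvd: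
  fixes f :: "'i \<Rightarrow> 'a::idom"
  assumes "finite I" "\<And>i. i \<in> I \<Longrightarrow> prime_elem (f i)" "\<And>i. i \<in> I \<Longrightarrow> f i dvd x"
    and "\<And>i j. i \<in> I \<Longrightarrow> j \<in> I \<Longrightarrow> i \<noteq> j \<Longrightarrow> \<not> f i dvd f j"
  shows "prod f I dvd x"
  using assms
proof (induction I rule: finite_induct)
  case (insert i I)
  then obtain y where y: "x = prod f I * y" by (auto elim: dvdE)
  have "\<not> f i dvd prod f I"
    using prime_elem_dvd_prod[of "f i" I f] insert.prems(1,3) insert.hyps
    by (metis insertCI)
  moreover have "f i dvd prod f I * y" using y insert.prems(2)[of i] by simp
  ultimately have "f i dvd y"
    using insert.prems(1)[of i] by (simp add: prime_elem_dvd_mult_iff)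
  then show ?case using insert.hyps y by (simp add: mult.commute[of "f i"] mult_dvd_mono)
qed simp

lemma linear_form_dvd_imp_vanishes:
  assumes "linear_form a dvd linear_form b" "(\<Sum>i\<in>UNIV. a $ i * v $ i) = 0"
  shows "(\<Sum>i\<in>UNIV. b $ i * v $ i) = (0::'k::field)"
proof -
  let ?ev = "subst (\<lambda>c. c) v"
  have ev: "?ev (linear_form c) = (\<Sum>i\<in>UNIV. c $ i * v $ i)" for c
    by (simp add: hom_linear_form[OF subst_hom[OF is_ring_hom_id]] subst_const subst_var is_ring_hom_id)
  from assms(1) obtain p where "linear_form b = linear_form a * p" by (elim dvdE)
  then show ?thesis
    using assms(2) ev by (metis is_ring_homD(4)[OF subst_hom[OF is_ring_hom_id]] mult_zero_left)
qed

locale arrangement =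
  fixes A :: "('k::field^3) set set" and \<alpha> :: "('k^3) set \<Rightarrow> 'k^3"
  assumes central: "central_arrangement A"
    and defining: "\<And>H. H \<in> A \<Longrightarrow> defines_hyperplane (\<alpha> H) H"
begin

abbreviation "Q \<equiv> defining_poly A \<alpha>"

lemma form_nonzero: "H \<in> A \<Longrightarrow> \<alpha> H \<noteq> 0"
  using defining by (auto simp: defines_hyperplane_def)

lemma forms_not_dvd:
  assumes "H \<in> A" "H' \<in> A" "H \<noteq> H'"
  shows "\<not> linear_form (\<alpha> H) dvd linear_form (\<alpha> H')"
proof
  assume dvd: "linear_form (\<alpha> H) dvd linear_form (\<alpha> H')"
  have "H \<subseteq> H'"
    using linear_form_dvd_imp_vanishes[OF dvd] defining[OF assms(1)] defining[OF assms(2)]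
    by (auto simp: defines_hyperplane_def)
  moreover have "vec.subspace H" "vec.subspace H'" "vec.dim H' \<le> vec.dim H"
    using central assms by (simp_all add: central_arrangement_def)
  ultimately show False using vec.subspace_dim_equal assms(3) by blast
qed

lemma Q_nonzero: "Q \<noteq> 0"
  using central form_nonzero by (auto simp: defining_poly_def central_arrangement_def linear_form_eq_0_iff)

lemma log_derD: "\<theta> \<in> log_der A \<Longrightarrow> H \<in> A \<Longrightarrow> linear_form (\<alpha> H) dvd der_apply \<theta> (linear_form (\<alpha> H))"
  using defining by (auto simp: log_der_def)

text \<open>
  Forms of distinct hyperplanes are non-associated primes, and each of them divides the determinant.
\<close>

lemma Q_dvd_det:
  assumes "u \<in> log_der A" "v \<in> log_der A" "w \<in> log_der A"
  shows "Q dvd det_rows u v w"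
  unfolding defining_poly_def
proof (rule prod_primes_dvd)
  show "finite A" using central by (simp add: central_arrangement_def)
  show "linear_form (\<alpha> H) dvd det_rows u v w" if "H \<in> A" for H
    using that assms by (intro linear_form_dvd_det form_nonzero) (auto intro: log_derD)
qed (use forms_not_dvd form_nonzero prime_elem_linear_form in auto)

end

lemma der_apply_0: "der_apply 0 p = 0"
  by (simp add: der_apply_def)

lemma der_apply_add: "der_apply (u + v) p = der_apply u p + der_apply v p"
  by (simp add: der_apply_def algebra_simps sum.distrib)

lemma der_apply_smult: "der_apply (c *s u) p = c * der_apply u p"
  by (simp add: der_apply_def sum_distrib_left mult.assoc)

lemma log_der_subspace: "module.subspace (*s) (log_der A)"
proof -
  interpret Modules.module "(*s) :: 'k::field S \<Rightarrow> 'k der \<Rightarrow> 'k der" by (rule module_der)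
  show ?thesis
    by (auto simp: subspace_def log_der_def der_apply_add der_apply_smult der_apply_0)
qed

lemma mem_span_family:
  fixes \<theta> :: "'i \<Rightarrow> 'k::field der"
  assumes "finite I"
  shows "\<eta> \<in> module.span (*s) (\<theta> ` I) \<longleftrightarrow> (\<exists>r. \<eta> = (\<Sum>i\<in>I. r i *s \<theta> i))"
proof -
  interpret Modules.module "(*s) :: 'k S \<Rightarrow> 'k der \<Rightarrow> 'k der" by (rule module_der)
  let ?M = "{\<eta>. \<exists>r. \<eta> = (\<Sum>i\<in>I. r i *s \<theta> i)}"
  have "subspace ?M"
  proof (rule subspaceI)
    show "0 \<in> ?M" by (auto intro!: exI[of _ "\<lambda>_. 0"])
    show "x + y \<in> ?M" if "x \<in> ?M" "y \<in> ?M" for x y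
    proof -
      from that obtain r s where "x = (\<Sum>i\<in>I. r i *s \<theta> i)" "y = (\<Sum>i\<in>I. s i *s \<theta> i)" by auto
      then have "x + y = (\<Sum>i\<in>I. (r i + s i) *s \<theta> i)" by (simp add: scale_left_distrib sum.distrib)
      then show ?thesis by (auto intro!: exI[of _ "\<lambda>i. r i + s i"])
    qed
    show "c *s x \<in> ?M" if "x \<in> ?M" for c x
    proof -
      from that obtain r where "x = (\<Sum>i\<in>I. r i *s \<theta> i)" by auto
      then have "c *s x = (\<Sum>i\<in>I. (c * r i) *s \<theta> i)" by (simp add: scale_sum_right)
      then show ?thesis by (auto intro!: exI[of _ "\<lambda>i. c * r i"])
    qed
  qed
  moreover have "\<theta> j \<in> ?M" if "j \<in> I" for j
    using assms that by (auto intro!: exI[of _ "\<lambda>i. if i = j then 1 else 0"] simp: if_distrib[of "\<lambda>c. c *s _"] cong: if_cong)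
  ultimately have "span (\<theta> ` I) \<subseteq> ?M" by (intro span_minimal) auto
  moreover have "?M \<subseteq> span (\<theta> ` I)"
  proof clarify
    fix r
    show "(\<Sum>i\<in>I. r i *s \<theta> i) \<in> span (\<theta> ` I)"
      by (intro span_sum span_scale) (simp add: span_base)
  qed
  ultimately show ?thesis by blast
qed

text \<open>
  If a defining form \<open>l\<close> did not divide \<open>\<psi>(l)\<close>, it would divide both \<open>p\<close> and \<open>h\<close>. As \<open>p\<close> is
  prime, it would be associated to \<open>l\<close> and divide \<open>h\<close>.
\<close>

lemma log_der_of_two_multiples:
  assumes "p *s \<psi> \<in> log_der A" "h *s \<psi> \<in> log_der A" "prime_elem p" "\<not> p dvd h"
  shows "\<psi> \<in> log_der A"
  unfolding log_der_def
proof (intro CollectI ballI allI impI)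
  fix H a assume H: "H \<in> A" "defines_hyperplane a H"
  let ?l = "linear_form a"
  have l: "prime_elem ?l" using H(2) by (intro prime_elem_linear_form) (simp add: defines_hyperplane_def)
  have p: "?l dvd p * der_apply \<psi> ?l" and h: "?l dvd h * der_apply \<psi> ?l"
    using assms(1,2) H by (auto simp: log_der_def der_apply_smult)
  show "?l dvd der_apply \<psi> ?l"
  proof (rule ccontr)
    assume "\<not> ?l dvd der_apply \<psi> ?l"
    then have "?l dvd p" and "?l dvd h" using l p h by (auto simp: prime_elem_dvd_mult_iff)
    then obtain e where e: "p = ?l * e" by (elim dvdE)
    moreover have "irreducible p" using assms(3) by simp
    moreover have "\<not> ?l dvd 1" using l by (rule prime_elem_not_unit)
    ultimately have "e dvd 1" using irreducibleD by blast
    then have "p dvd ?l" unfolding e by (simp add: mult_unit_dvd_iff)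
    with \<open>?l dvd h\<close> assms(4) show False by (meson dvd_trans)
  qed
qed

section \<open>Four logarithmic derivations\<close>

lemma sum_1_3: "(\<Sum>i=1..3. f i) = f 1 + f 2 + (f (3::nat) :: 'a::comm_monoid_add)"
  by (simp add: numeral_eq_Suc atLeastAtMostSuc_conv add_ac)

lemma sum_1_4: "(\<Sum>i=1..4. f i) = (\<Sum>i=1..3. f i) + (f (4::nat) :: 'a::comm_monoid_add)"
  by (simp add: numeral_eq_Suc atLeastAtMostSuc_conv add_ac)

lemma nat_1_3_cases: "i \<in> {1..3::nat} \<longleftrightarrow> i = 1 \<or> i = 2 \<or> i = 3"
  by (simp, presburger)

lemma nat_1_4_cases: "i \<in> {1..4::nat} \<longleftrightarrow> i \<in> {1..3} \<or> i = 4"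
  by (simp, presburger)

lemma is_relation_iff: "is_relation r \<theta> \<longleftrightarrow> (\<Sum>i=1..3. r i *s \<theta> i) = - (r 4 *s \<theta> 4)"
  unfolding is_relation_def sum_1_4 eq_neg_iff_add_eq_0 ..

lemma smult_cancel:
  fixes u v :: "'a::idom^'n"
  assumes "c *s u = c *s v" "c \<noteq> 0"
  shows "u = v"
  using assms by (simp add: Finite_Cartesian_Product.vec_eq_iff)

lemma det_rows_combination:
  "det_rows (a *s u + b *s v + c *s w) v w = a * det_rows u v w"
  "det_rows u (a *s u + b *s v + c *s w) w = b * det_rows u v w"
  "det_rows u v (a *s u + b *s v + c *s w) = c * det_rows u v w"
  unfolding det_rows_expand by (simp_all add: algebra_simps)

locale four_log_derivations = arrangement A \<alpha>
  for A :: "('k::field^3) set set" and \<alpha> +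
  fixes \<theta> :: "nat \<Rightarrow> 'k der" and g :: "nat \<Rightarrow> 'k S"
  assumes log: "i \<in> {1..4} \<Longrightarrow> \<theta> i \<in> log_der A"
    and homog: "i \<in> {1..4} \<Longrightarrow> homogeneous_der (\<theta> i)"
    and minors: "i \<in> {1..4} \<Longrightarrow> (-1) ^ i * det (delete_row \<theta> i) = g i * defining_poly A \<alpha>"
begin

lemma minors_explicit:
  "det_rows (\<theta> 2) (\<theta> 3) (\<theta> 4) = - (g 1 * Q)" "det_rows (\<theta> 1) (\<theta> 3) (\<theta> 4) = g 2 * Q"
  "det_rows (\<theta> 1) (\<theta> 2) (\<theta> 4) = - (g 3 * Q)" "det_rows (\<theta> 1) (\<theta> 2) (\<theta> 3) = g 4 * Q"
  using minors[of 1, symmetric] minors[of 2, symmetric] minors[of 3, symmetric] minors[of 4, symmetric]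
  unfolding delete_row_simps by simp_all

text \<open>
  Up to the factor \<open>- Q\<close> this is Cramer's rule; the signs \<open>(-1)^i\<close> are those of the cofactor
  expansion.
\<close>

lemma g_relation: "is_relation g \<theta>"
proof -
  have "Q *s (g 1 *s \<theta> 1 + g 2 *s \<theta> 2 + g 3 *s \<theta> 3 + g 4 *s \<theta> 4)
    = - (det_rows (\<theta> 2) (\<theta> 3) (\<theta> 4) *s \<theta> 1 - det_rows (\<theta> 1) (\<theta> 3) (\<theta> 4) *s \<theta> 2
      + det_rows (\<theta> 1) (\<theta> 2) (\<theta> 4) *s \<theta> 3 - det_rows (\<theta> 1) (\<theta> 2) (\<theta> 3) *s \<theta> 4)"
    unfolding minors_explicit Finite_Cartesian_Product.vec_eq_iff forall_3 by (simp add: algebra_simps)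
  also have "\<dots> = Q *s 0" unfolding cramer_relation by simp
  finally have "g 1 *s \<theta> 1 + g 2 *s \<theta> 2 + g 3 *s \<theta> 3 + g 4 *s \<theta> 4 = 0"
    using Q_nonzero by (rule smult_cancel)
  then show ?thesis by (simp only: is_relation_def sum_1_4 sum_1_3)
qed

lemma g_homogeneous:
  assumes "i \<in> {1..4}"
  shows "\<exists>d. homogeneous d (g i)"
proof (cases "g i = 0")
  case True
  then show ?thesis by (simp add: homogeneous_def is_ring_homD[OF grade_hom])
next
  case False
  have det: "\<exists>d. homogeneous d (det_rows u v w)" if "homogeneous_der u" "homogeneous_der v" "homogeneous_der w" for u v w :: "'k der"
  proof -
    from that obtain d e f where "\<And>j. homogeneous d (u $ j)" "\<And>j. homogeneous e (v $ j)" "\<And>j. homogeneous f (w $ j)"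
      unfolding homogeneous_der_def by (meson S_deg_homogeneous)
    then have "\<And>i j k. homogeneous (d + e + f) (u $ i * v $ j * w $ k)"
      by (intro homogeneous_mult)
    then have "homogeneous (d + e + f) (det_rows u v w)"
      unfolding det_rows_expand by (intro homogeneous_add homogeneous_diff)
    then show ?thesis by blast
  qed
  have "\<exists>d. homogeneous d (g i * Q)"
    using assms det[of "\<theta> 2" "\<theta> 3" "\<theta> 4"] det[of "\<theta> 1" "\<theta> 3" "\<theta> 4"] det[of "\<theta> 1" "\<theta> 2" "\<theta> 4"] det[of "\<theta> 1" "\<theta> 2" "\<theta> 3"]
    unfolding nat_1_4_cases nat_1_3_cases minors_explicit
    by (auto simp: homog homogeneous_uminus_iff)
  with False Q_nonzero show ?thesis using homogeneous_factor by (metis mult_eq_0_iff)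
qed

text \<open>
  The coefficients are quotients by \<open>Q\<close> of minors of \<open>\<eta>, \<theta>_1, \<theta>_2, \<theta>_3\<close>. The congruence for
  \<open>i\<close> and \<open>j\<close> is the Pluecker relation for the minors of \<open>\<eta>, \<theta>_1, \<dots>, \<theta>_4\<close> that contain
  \<open>\<theta>_k\<close>, where \<open>k\<close> is the third index: its term other than \<open>c_i g_j\<close> and \<open>c_j g_i\<close> contains the
  factor \<open>[\<theta>_1 \<theta>_2 \<theta>_3] = g_4 Q\<close>, and the cofactor \<open>[\<eta> \<theta>_4 \<theta>_k]\<close> is again divisible by \<open>Q\<close>.
\<close>

lemma cramer_coefficients:
  assumes "\<eta> \<in> log_der A"
  obtains c where "g 4 *s \<eta> = (\<Sum>i=1..3. c i *s \<theta> i)"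
    "\<And>i j. i \<in> {1..3} \<Longrightarrow> j \<in> {1..3} \<Longrightarrow> g 4 dvd c i * g j - c j * g i"
proof -
  have Q_dvd: "\<exists>p. det_rows \<eta> (\<theta> i) (\<theta> j) = p * Q" if "i \<in> {1..4}" "j \<in> {1..4}" for i j
    using Q_dvd_det[OF assms log[OF that(1)] log[OF that(2)]] by (metis dvdE mult.commute)
  obtain c1 where c1: "det_rows \<eta> (\<theta> 2) (\<theta> 3) = c1 * Q" using Q_dvd[of 2 3] by auto
  obtain c2 where c2: "det_rows \<eta> (\<theta> 3) (\<theta> 1) = c2 * Q" using Q_dvd[of 3 1] by auto
  obtain c3 where c3: "det_rows \<eta> (\<theta> 1) (\<theta> 2) = c3 * Q" using Q_dvd[of 1 2] by auto
  obtain m1 where m1: "det_rows \<eta> (\<theta> 4) (\<theta> 1) = m1 * Q" using Q_dvd[of 4 1] by auto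
  obtain m2 where m2: "det_rows \<eta> (\<theta> 4) (\<theta> 2) = m2 * Q" using Q_dvd[of 4 2] by auto
  obtain m3 where m3: "det_rows \<eta> (\<theta> 4) (\<theta> 3) = m3 * Q" using Q_dvd[of 4 3] by auto
  define c where "c = (\<lambda>i::nat. if i = 1 then c1 else if i = 2 then c2 else c3)"
  have c: "c 1 = c1" "c 2 = c2" "c 3 = c3" by (simp_all add: c_def)
  have minors_\<eta>:
    "det_rows \<eta> (\<theta> 1) (\<theta> 3) = - (c2 * Q)" "det_rows (\<theta> 1) \<eta> (\<theta> 3) = c2 * Q" "det_rows (\<theta> 3) \<eta> (\<theta> 1) = - (c2 * Q)"
    "det_rows (\<theta> 2) \<eta> (\<theta> 3) = - (c1 * Q)" "det_rows (\<theta> 3) \<eta> (\<theta> 2) = c1 * Q"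
    "det_rows (\<theta> 1) \<eta> (\<theta> 2) = - (c3 * Q)" "det_rows (\<theta> 2) \<eta> (\<theta> 1) = c3 * Q"
    using c1 c2 c3 unfolding det_rows_expand by (simp_all add: algebra_simps)
  have minors_\<theta>:
    "det_rows (\<theta> 2) (\<theta> 4) (\<theta> 3) = g 1 * Q" "det_rows (\<theta> 3) (\<theta> 4) (\<theta> 2) = - (g 1 * Q)"
    "det_rows (\<theta> 1) (\<theta> 4) (\<theta> 3) = - (g 2 * Q)" "det_rows (\<theta> 3) (\<theta> 4) (\<theta> 1) = g 2 * Q"
    "det_rows (\<theta> 1) (\<theta> 4) (\<theta> 2) = g 3 * Q" "det_rows (\<theta> 2) (\<theta> 4) (\<theta> 1) = - (g 3 * Q)"
    "det_rows (\<theta> 1) (\<theta> 3) (\<theta> 2) = - (g 4 * Q)" "det_rows (\<theta> 2) (\<theta> 3) (\<theta> 1) = g 4 * Q"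
    using minors_explicit unfolding det_rows_expand by (simp_all add: algebra_simps)
  have "Q *s (g 4 *s \<eta>) - Q *s (\<Sum>i=1..3. c i *s \<theta> i)
     = det_rows (\<theta> 1) (\<theta> 2) (\<theta> 3) *s \<eta> - det_rows \<eta> (\<theta> 2) (\<theta> 3) *s \<theta> 1
       + det_rows \<eta> (\<theta> 1) (\<theta> 3) *s \<theta> 2 - det_rows \<eta> (\<theta> 1) (\<theta> 2) *s \<theta> 3"
    unfolding minors_explicit minors_\<eta> c1 c3 sum_1_3 c Finite_Cartesian_Product.vec_eq_iff forall_3
    by (simp add: algebra_simps)
  then have "Q *s (g 4 *s \<eta>) = Q *s (\<Sum>i=1..3. c i *s \<theta> i)"
    unfolding cramer_relation by simp
  then have 1: "g 4 *s \<eta> = (\<Sum>i=1..3. c i *s \<theta> i)" using Q_nonzero by (rule smult_cancel)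
  have dvd: "g 4 dvd p" if "g 4 * m * (Q * Q) = p * (Q * Q)" for p m
    using that Q_nonzero by (metis dvd_triv_left mult_right_cancel mult_eq_0_iff)
  note minor_values = minors_explicit minors_\<eta> minors_\<theta> c1 c2 c3 m1 m2 m3
  have 12: "g 4 dvd c1 * g 2 - c2 * g 1"
    using pluecker_relation[of "\<theta> 1" "\<theta> 2" "\<theta> 3" \<eta> "\<theta> 4"]
    unfolding minor_values by (intro dvd[of "- m3"]) (simp add: algebra_simps)
  have 13: "g 4 dvd c1 * g 3 - c3 * g 1"
    using pluecker_relation[of "\<theta> 1" "\<theta> 3" "\<theta> 2" \<eta> "\<theta> 4"]
    unfolding minor_values by (intro dvd[of m2]) (simp add: algebra_simps)
  have 23: "g 4 dvd c2 * g 3 - c3 * g 2"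
    using pluecker_relation[of "\<theta> 2" "\<theta> 3" "\<theta> 1" \<eta> "\<theta> 4"]
    unfolding minor_values by (intro dvd[of "- m1"]) (simp add: algebra_simps)
  have sym: "g 4 dvd y - x" if "g 4 dvd x - y" for x y
    using that by (metis dvd_minus_iff minus_diff_eq)
  have "g 4 dvd c i * g j - c j * g i" if "i \<in> {1..3}" "j \<in> {1..3}" for i j
    using that 12 13 23 sym[OF 12] sym[OF 13] sym[OF 23]
    unfolding nat_1_3_cases by (auto simp: c simp del: One_nat_def)
  with 1 show thesis by (rule that)
qed

text \<open>
  Replacing \<open>\<theta>_i\<close> by the vanishing combination multiplies \<open>[\<theta>_1 \<theta>_2 \<theta>_3] = g_4 Q\<close> by \<open>s i\<close>.
\<close>

lemma independent:
  assumes "(\<Sum>i=1..3. s i *s \<theta> i) = 0" "g 4 \<noteq> 0" "i \<in> {1..3}"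
  shows "s i = 0"
proof -
  have z: "det_rows 0 v w = 0" "det_rows v 0 w = 0" "det_rows v w 0 = 0" for v w :: "'k der"
    unfolding det_rows_expand by simp_all
  have "s i * (g 4 * Q) = 0"
    using assms(1,3) det_rows_combination[where a = "s 1" and u = "\<theta> 1" and b = "s 2" and v = "\<theta> 2" and c = "s 3" and w = "\<theta> 3"]
    unfolding sum_1_3 nat_1_3_cases minors_explicit by (auto simp: z)
  then show ?thesis using assms(2) Q_nonzero by simp
qed

end

section \<open>Sufficiency of the condition\<close>

locale generation_criterion = four_log_derivations +
  assumes linear: "g 4 \<in> S_deg 1 - {0}"
    and positive: "i \<in> {1..3} \<Longrightarrow> g i \<in> S_pos"
    and no_common_divisor: "\<nexists>h. common_divisor_mod h (g ` {1..3}) (g 4)"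
begin

lemma g4_linear_form: obtains a where "a \<noteq> 0" "g 4 = linear_form a"
  using linear S_deg_1_cases[of "g 4"] by (metis Diff_iff linear_form_eq_0_iff singletonI)

lemma g4_prime: "prime_elem (g 4)"
  using g4_linear_form prime_elem_linear_form by metis

lemma g4_S_pos: "g 4 \<in> S_pos"
  using linear by (auto simp: S_pos_def S_deg_def)

lemma not_all_dvd: "\<exists>i\<in>{1..3}. \<not> g 4 dvd g i"
  using no_common_divisor_mod_imp_not_all_dvd[OF no_common_divisor g4_S_pos] .

text \<open>
  The relation \<open>g_4 r - r_4 g\<close> does not involve \<open>\<theta>_4\<close>, so it vanishes. Since the prime \<open>g_4\<close> does not
  divide all \<open>g_i\<close>, it divides \<open>r_4\<close>.
\<close>

lemma relation_multiple:
  assumes "is_relation r \<theta>"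
  shows "\<exists>c. \<forall>i\<in>{1..4}. r i = c * g i"
proof -
  have nz: "g 4 \<noteq> 0" using linear by simp
  have "(\<Sum>i=1..3. (g 4 * r i - r 4 * g i) *s \<theta> i)
      = g 4 *s (\<Sum>i=1..3. r i *s \<theta> i) - r 4 *s (\<Sum>i=1..3. g i *s \<theta> i)"
    unfolding sum_1_3 Finite_Cartesian_Product.vec_eq_iff forall_3 by (simp add: algebra_simps)
  also have "\<dots> = 0"
    using assms g_relation unfolding is_relation_iff
    by (simp add: Finite_Cartesian_Product.vec_eq_iff)
  finally have "g 4 * r i - r 4 * g i = 0" if "i \<in> {1..3}" for i
    using independent[OF _ nz that, of "\<lambda>i. g 4 * r i - r 4 * g i"] by blast
  then have eq: "g 4 * r i = r 4 * g i" if "i \<in> {1..3}" for i using that by auto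
  obtain i where i: "i \<in> {1..3}" "\<not> g 4 dvd g i" using not_all_dvd by blast
  have "g 4 dvd r 4 * g i" using eq[OF i(1)] by (metis dvd_triv_left)
  with i g4_prime have "g 4 dvd r 4" by (simp add: prime_elem_dvd_mult_iff)
  then obtain c where c: "r 4 = c * g 4" by (metis dvdE mult.commute)
  have "r i = c * g i" if "i \<in> {1..3}" for i
  proof -
    have "g 4 * r i = g 4 * (c * g i)" using eq[OF that] c by (simp add: mult_ac)
    with nz show ?thesis by simp
  qed
  then have "r i = c * g i" if "i \<in> {1..4}" for i using that c unfolding nat_1_4_cases by blast
  then show ?thesis by blast
qed

lemma g_minimal_degree: "minimal_degree_relation g \<theta>"
  unfolding minimal_degree_relation_def
proof (intro conjI allI impI g_relation)
  fix h assume h: "\<forall>i\<in>{1..4}. h dvd g i"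
  then have "h dvd g 4" by simp
  then obtain e where e: "g 4 = h * e" by (elim dvdE)
  have "irreducible (g 4)" using g4_prime by simp
  with e have "h dvd 1 \<or> e dvd 1" by (rule irreducibleD[rotated])
  moreover have "\<not> e dvd 1"
  proof
    assume "e dvd 1"
    then have "g 4 dvd h" unfolding e by (simp add: mult_unit_dvd_iff)
    with h have "g 4 dvd g i" if "i \<in> {1..3}" for i
      using that nat_1_4_cases by (meson dvd_trans)
    with not_all_dvd show False by blast
  qed
  ultimately show "is_unit h" by blast
qed

text \<open>
  The congruences \<open>c_i = t g_i\<close> modulo \<open>g_4\<close> turn \<open>g_4 \<eta> = \<Sum> c_i \<theta>_i\<close> into
  \<open>g_4 \<eta> = t \<Sum> g_i \<theta>_i + g_4 \<Sum> b_i \<theta>_i\<close> with sums over \<open>i \<le> 3\<close>, and the first sum is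
  \<open>- g_4 \<theta>_4\<close>.
\<close>

lemma spanning: "module.span (*s) (\<theta> ` {1..4}) = log_der A"
proof
  show "module.span (*s) (\<theta> ` {1..4}) \<subseteq> log_der A"
    by (rule module.span_minimal[OF module_der _ log_der_subspace]) (use log in blast)
  show "log_der A \<subseteq> module.span (*s) (\<theta> ` {1..4})"
  proof
    fix \<eta> assume "\<eta> \<in> log_der A"
    then obtain c where c: "g 4 *s \<eta> = (\<Sum>i=1..3. c i *s \<theta> i)"
      and proportional: "\<And>i j. i \<in> {1..3} \<Longrightarrow> j \<in> {1..3} \<Longrightarrow> g 4 dvd c i * g j - c j * g i"
      using cramer_coefficients by blast
    obtain a where a: "a \<noteq> 0" "g 4 = linear_form a" by (rule g4_linear_form)
    obtain t where "\<forall>i\<in>{1..3}. g 4 dvd c i - t * g i"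
      using proportional_mod_linear_form[OF a _ no_common_divisor proportional] g_homogeneous by auto
    then have "\<forall>i. \<exists>b. i \<in> {1..3} \<longrightarrow> c i - t * g i = g 4 * b" by (auto simp: dvd_def)
    then obtain b where b: "\<And>i. i \<in> {1..3} \<Longrightarrow> c i - t * g i = g 4 * b i" by metis
    have "c i = t * g i + g 4 * b i" if "i \<in> {1..3}" for i using b[OF that] by (simp add: algebra_simps)
    then have "g 4 *s \<eta> = (\<Sum>i=1..3. (t * g i + g 4 * b i) *s \<theta> i)" by (simp add: c)
    also have "\<dots> = t *s (\<Sum>i=1..3. g i *s \<theta> i) + g 4 *s (\<Sum>i=1..3. b i *s \<theta> i)"
      unfolding sum_1_3 Finite_Cartesian_Product.vec_eq_iff forall_3 by (simp add: algebra_simps)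
    also have "\<dots> = g 4 *s ((\<Sum>i=1..3. b i *s \<theta> i) + (- t) *s \<theta> 4)"
      using g_relation unfolding is_relation_iff Finite_Cartesian_Product.vec_eq_iff forall_3 by (simp add: algebra_simps)
    finally have "\<eta> = (\<Sum>i=1..3. b i *s \<theta> i) + (- t) *s \<theta> 4"
      by (rule smult_cancel) (use linear in simp)
    also have "\<dots> = (\<Sum>i=1..4. (b(4 := - t)) i *s \<theta> i)"
      unfolding sum_1_4 sum_1_3 by simp
    finally show "\<eta> \<in> module.span (*s) (\<theta> ` {1..4})"
      by (subst mem_span_family) blast+
  qed
qed

lemma relation_coefficient_in_S_pos:
  assumes "is_relation r \<theta>" "i \<in> {1..4}"
  shows "r i \<in> S_pos"
proof -
  obtain c where "r i = c * g i" using relation_multiple[OF assms(1)] assms(2) by blast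
  moreover have "g i \<in> S_pos" using assms(2) positive g4_S_pos unfolding nat_1_4_cases by blast
  ultimately show ?thesis by (simp add: S_pos_iff mcoeff_0)
qed

lemma not_in_span_others:
  assumes "i \<in> {1..4}"
  shows "\<theta> i \<notin> module.span (*s) (\<theta> ` ({1..4} - {i}))"
proof
  assume "\<theta> i \<in> module.span (*s) (\<theta> ` ({1..4} - {i}))"
  then obtain r where r: "\<theta> i = (\<Sum>j\<in>{1..4}-{i}. r j *s \<theta> j)"
    by (subst (asm) mem_span_family) auto
  have "(\<Sum>j=1..4. (r(i := - 1)) j *s \<theta> j) = - \<theta> i + (\<Sum>j\<in>{1..4}-{i}. (r(i := - 1)) j *s \<theta> j)"
    using assms by (subst sum.remove[of _ i]) (auto simp flip: vector_sneg_minus1)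
  also have "(\<Sum>j\<in>{1..4}-{i}. (r(i := - 1)) j *s \<theta> j) = \<theta> i"
    unfolding r by (rule sum.cong) auto
  finally have "is_relation (r(i := - 1)) \<theta>" by (simp add: is_relation_def)
  from relation_coefficient_in_S_pos[OF this assms] show False by (simp add: S_pos_iff mcoeff_0)
qed

lemma SPOG_generators: "SPOG_generators A \<theta>"
proof -
  have inj: "inj_on \<theta> {1..4}"
  proof (rule inj_onI, rule ccontr)
    fix i j assume ij: "i \<in> {1..4}" "j \<in> {1..4::nat}" "\<theta> i = \<theta> j" "i \<noteq> j"
    then have "\<theta> i \<in> \<theta> ` ({1..4} - {i})" by auto
    then show False
      using not_in_span_others[OF ij(1)] by (simp add: module.span_base[OF module_der])
  qed
  have "module.span (*s) C \<noteq> log_der A" if C: "C \<subset> \<theta> ` {1..4}" for C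
  proof
    assume span: "module.span (*s) C = log_der A"
    from C obtain i where i: "i \<in> {1..4}" "\<theta> i \<notin> C" by blast
    then have "C \<subseteq> \<theta> ` ({1..4} - {i})" using C by blast
    then have "log_der A \<subseteq> module.span (*s) (\<theta> ` ({1..4} - {i}))"
      unfolding span[symmetric] by (rule module.span_mono[OF module_der])
    with log[OF i(1)] have "\<theta> i \<in> module.span (*s) (\<theta> ` ({1..4} - {i}))" by blast
    with not_in_span_others[OF i(1)] show False by blast
  qed
  then have "minimal_homogeneous_generators A \<theta>"
    using inj homog spanning by (simp add: minimal_homogeneous_generators_def minimal_generating_set_def)
  moreover have "generating_relation g \<theta>"
    using g_relation relation_multiple by (simp add: generating_relation_def)
  ultimately show ?thesis using linear by (auto simp: SPOG_generators_def)
qed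

end

section \<open>Necessity of the condition\<close>

locale SPOG_family = four_log_derivations +
  assumes SPOG: "SPOG_generators A \<theta>"
    and min_degree: "minimal_degree_relation g \<theta>"
begin

text \<open>
  By uniqueness \<open>g = c f\<close> for the generating relation \<open>f\<close>, and \<open>c\<close> is a unit because it is a common
  divisor of the \<open>g_i\<close>. So \<open>g\<close> inherits the properties of \<open>f\<close>.
\<close>

lemma g_linear_and_generating: "g 4 \<in> S_deg 1 - {0} \<and> generating_relation g \<theta>"
proof -
  from SPOG obtain f where f: "generating_relation f \<theta>" "f 4 \<in> S_deg 1" "f 4 \<noteq> 0"
    by (auto simp: SPOG_generators_def)
  then obtain c where c: "\<And>i. i \<in> {1..4} \<Longrightarrow> g i = c * f i"
    using g_relation unfolding generating_relation_def by blast
  then have unit: "c dvd 1"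
    using min_degree unfolding minimal_degree_relation_def by (metis dvd_triv_left)
  then obtain k where k: "k \<noteq> 0" "c = const k" by (rule unit_is_const)
  from unit obtain e where e: "1 = c * e" by (elim dvdE)
  obtain a where a: "f 4 = linear_form a" using f(2) by (rule S_deg_1_cases)
  have "g 4 = linear_form (\<chi> i. k * a $ i)"
    using c[of 4] a k
    by (simp add: linear_form_def sum_distrib_left is_ring_homD[OF const_hom] mult.assoc)
  then have "g 4 \<in> S_deg 1" using linear_form_in_S_deg by metis
  moreover have "g 4 \<noteq> 0" using c[of 4] f(3) unit by auto
  moreover have "\<exists>d. \<forall>i\<in>{1..4}. r i = d * g i" if "is_relation r \<theta>" for r
  proof -
    from f(1) that obtain d where d: "\<forall>i\<in>{1..4}. r i = d * f i" unfolding generating_relation_def by blast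
    have "r i = (d * e) * g i" if "i \<in> {1..4}" for i
    proof -
      have "r i = d * (c * e) * f i" using d that e by simp
      then show ?thesis using c[OF that] by (simp add: mult_ac)
    qed
    then show ?thesis by blast
  qed
  ultimately show ?thesis using g_relation by (simp add: generating_relation_def)
qed

lemma span_generators: "module.span (*s) (\<theta> ` {1..4}) = log_der A"
  using SPOG by (simp add: SPOG_generators_def minimal_homogeneous_generators_def minimal_generating_set_def)

text \<open>
  A homogeneous \<open>g_i\<close> with nonzero constant term is a unit, and the relation \<open>g\<close> then expresses
  \<open>\<theta>_i\<close> by the other generators.
\<close>

lemma g_positive:
  assumes "i \<in> {1..4}"
  shows "g i \<in> S_pos"
proof (rule ccontr)
  interpret Modules.module "(*s) :: 'a S \<Rightarrow> 'a der \<Rightarrow> 'a der" by (rule module_der)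
  let ?B = "\<theta> ` ({1..4} - {i})"
  assume "g i \<notin> S_pos"
  then have "g i dvd 1" using g_homogeneous[OF assms] homogeneous_unit_or_S_pos by blast
  then obtain e where e: "1 = g i * e" by (elim dvdE)
  have "g i *s \<theta> i + (\<Sum>j\<in>{1..4}-{i}. g j *s \<theta> j) = 0"
    using g_relation assms unfolding is_relation_def by (subst (asm) sum.remove[of _ i]) auto
  then have gi: "g i *s \<theta> i = - (\<Sum>j\<in>{1..4}-{i}. g j *s \<theta> j)"
    by (simp add: eq_neg_iff_add_eq_0)
  have "- (\<Sum>j\<in>{1..4}-{i}. g j *s \<theta> j) \<in> span ?B"
    by (intro span_neg span_sum span_scale) (simp add: span_base)
  then have "e *s (g i *s \<theta> i) \<in> span ?B" unfolding gi by (rule span_scale)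
  then have in_span: "\<theta> i \<in> span ?B" using e by (simp add: mult.commute)
  have "\<theta> ` {1..4} \<subseteq> span ?B"
  proof
    fix x assume "x \<in> \<theta> ` {1..4}"
    then show "x \<in> span ?B" using in_span by (cases "x = \<theta> i") (auto intro: span_base)
  qed
  then have "log_der A \<subseteq> span ?B" using span_minimal[OF _ subspace_span] span_generators by blast
  moreover have "span ?B \<subseteq> span (\<theta> ` {1..4})" by (rule span_mono) blast
  ultimately have "span ?B = log_der A" using span_generators by blast
  moreover have "?B \<subset> \<theta> ` {1..4}"
  proof -
    have "inj_on \<theta> {1..4}" using SPOG by (simp add: SPOG_generators_def minimal_homogeneous_generators_def)
    then have "\<theta> i \<notin> ?B" using assms by (auto simp: inj_on_def)
    then show ?thesis using assms by blast
  qed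
  ultimately show False
    using SPOG by (simp add: SPOG_generators_def minimal_homogeneous_generators_def minimal_generating_set_def)
qed

text \<open>
  A common divisor \<open>h\<close> modulo \<open>g_4\<close> produces the logarithmic derivation \<open>\<psi> = (\<Sum> a_i \<theta>_i) / g_4\<close> with
  \<open>h \<psi> + \<theta>_4 + \<Sum> b_i \<theta>_i = 0\<close>. Once \<open>\<psi>\<close> is a combination of the generators, this is a
  relation whose coefficient at \<open>\<theta>_4\<close> has constant term \<open>1\<close>, because \<open>h\<close> has none.
\<close>

lemma no_common_divisor: "\<not> common_divisor_mod h (g ` {1..3}) (g 4)"
proof
  assume "common_divisor_mod h (g ` {1..3}) (g 4)"
  then have h: "h \<in> S_pos" and "\<forall>i. \<exists>a b. i \<in> {1..3} \<longrightarrow> g i = a * h + b * g 4"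
    by (auto simp: common_divisor_mod_def)
  then obtain a b where ab: "\<And>i. i \<in> {1..3} \<Longrightarrow> g i = a i * h + b i * g 4" by metis
  have linear: "g 4 \<in> S_deg 1" "g 4 \<noteq> 0" and gen: "generating_relation g \<theta>"
    using g_linear_and_generating by auto
  obtain l where l: "g 4 = linear_form l" using linear(1) by (rule S_deg_1_cases)
  with linear(2) have "l \<noteq> 0" by (simp add: linear_form_eq_0_iff)
  then have prime: "prime_elem (g 4)" unfolding l by (rule prime_elem_linear_form)
  have not_dvd: "\<not> g 4 dvd h"
  proof
    assume "g 4 dvd h"
    then have "g 4 dvd g i" if "i \<in> {1..4}" for i
      using that ab unfolding nat_1_4_cases by auto
    then have "g 4 dvd 1" using min_degree unfolding minimal_degree_relation_def by blast
    with prime_elem_not_unit[OF prime] show False by blast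
  qed
  have rel: "h *s (\<Sum>i=1..3. a i *s \<theta> i) = g 4 *s (- (\<theta> 4 + (\<Sum>i=1..3. b i *s \<theta> i)))"
  proof -
    have "(\<Sum>i=1..3. (a i * h + b i * g 4) *s \<theta> i) = - (g 4 *s \<theta> 4)"
      using g_relation ab by (simp add: is_relation_iff)
    then show ?thesis
      unfolding sum_1_3 Finite_Cartesian_Product.vec_eq_iff forall_3 by (simp add: algebra_simps eq_neg_iff_add_eq_0)
  qed
  have "\<exists>q. (\<Sum>i=1..3. a i *s \<theta> i) $ j = g 4 * q" for j
  proof -
    have "g 4 dvd h * (\<Sum>i=1..3. a i *s \<theta> i) $ j"
      using arg_cong[OF rel, of "\<lambda>v. v $ j"] unfolding vector_smult_component by (rule dvdI)
    from prime_elem_dvd_multD[OF prime this] not_dvd have "g 4 dvd (\<Sum>i=1..3. a i *s \<theta> i) $ j"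
      by simp
    then show ?thesis unfolding dvd_def .
  qed
  then obtain q where q: "\<And>j. (\<Sum>i=1..3. a i *s \<theta> i) $ j = g 4 * q j" by metis
  define \<psi> where "\<psi> = (\<chi> j. q j)"
  have \<psi>: "(\<Sum>i=1..3. a i *s \<theta> i) = g 4 *s \<psi>"
    unfolding Finite_Cartesian_Product.vec_eq_iff vector_smult_component \<psi>_def vec_lambda_beta
    using q by blast
  have "g 4 *s (h *s \<psi>) = h *s (g 4 *s \<psi>)" by (simp add: mult.commute)
  also have "\<dots> = g 4 *s (- (\<theta> 4 + (\<Sum>i=1..3. b i *s \<theta> i)))" unfolding \<psi>[symmetric] by (rule rel)
  finally have h\<psi>: "h *s \<psi> = - (\<theta> 4 + (\<Sum>i=1..3. b i *s \<theta> i))"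
    using linear(2) by (rule smult_cancel)
  interpret Modules.module "(*s) :: 'a S \<Rightarrow> 'a der \<Rightarrow> 'a der" by (rule module_der)
  have "g 4 *s \<psi> \<in> log_der A"
    unfolding \<psi>[symmetric] by (intro subspace_sum[OF log_der_subspace] subspace_scale[OF log_der_subspace] log) auto
  moreover have "h *s \<psi> \<in> log_der A"
    unfolding h\<psi> by (intro subspace_neg[OF log_der_subspace] subspace_add[OF log_der_subspace]
      subspace_sum[OF log_der_subspace] subspace_scale[OF log_der_subspace] log) auto
  ultimately have "\<psi> \<in> log_der A"
    using prime not_dvd by (rule log_der_of_two_multiples)
  then obtain c where c: "\<psi> = (\<Sum>i=1..4. c i *s \<theta> i)"
    unfolding span_generators[symmetric] by (subst (asm) mem_span_family) auto
  define r where "r = (\<lambda>i. if i = 4 then h * c 4 + 1 else h * c i + b i)"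
  have "is_relation r \<theta>"
  proof -
    have "(\<Sum>i=1..3. r i *s \<theta> i) = (\<Sum>i=1..3. (h * c i + b i) *s \<theta> i)"
      by (rule sum.cong) (auto simp: r_def)
    moreover have "r 4 = h * c 4 + 1" by (simp add: r_def)
    ultimately show ?thesis
      using h\<psi> unfolding c is_relation_iff sum_1_4 sum_1_3 Finite_Cartesian_Product.vec_eq_iff forall_3
      by (simp add: algebra_simps eq_neg_iff_add_eq_0)
  qed
  with gen obtain d where "\<forall>i\<in>{1..4}. r i = d * g i" unfolding generating_relation_def by blast
  then have "r 4 = d * g 4" by simp
  moreover have "mcoeff (g 4) 0 0 0 = 0" using g_positive[of 4] by (simp add: S_pos_iff)
  ultimately have "mcoeff (h * c 4 + 1) 0 0 0 = 0" by (simp add: r_def mcoeff_0)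
  then show False using h by (simp add: S_pos_iff mcoeff_0)
qed

end

theorem theorem1p4:
  fixes A :: "('k::field^3) set set"
    and \<alpha> :: "('k^3) set \<Rightarrow> 'k^3"
    and \<theta> :: "nat \<Rightarrow> 'k der"
    and g :: "nat \<Rightarrow> 'k S"
  assumes "central_arrangement A"
    and "\<forall>H\<in>A. defines_hyperplane (\<alpha> H) H"
    and "\<forall>i\<in>{1..4}. \<theta> i \<in> log_der A \<and> homogeneous_der (\<theta> i)"
    and "\<forall>i\<in>{1..4}. (-1) ^ i * det (delete_row \<theta> i) = g i * defining_poly A \<alpha>"
  shows "(SPOG A \<and> SPOG_generators A \<theta> \<and> minimal_degree_relation g \<theta>) \<longleftrightarrow>
    (g 4 \<in> S_deg 1 - {0} \<and> (\<forall>i\<in>{1..3}. g i \<in> S_pos) \<and>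
     \<not> (\<exists>h. common_divisor_mod h (g ` {1..3}) (g 4)))"
proof -
  interpret four_log_derivations A \<alpha> \<theta> g
    using assms by unfold_locales auto
  show ?thesis
  proof
    assume "SPOG A \<and> SPOG_generators A \<theta> \<and> minimal_degree_relation g \<theta>"
    then interpret SPOG_family A \<alpha> \<theta> g by unfold_locales auto
    show "g 4 \<in> S_deg 1 - {0} \<and> (\<forall>i\<in>{1..3}. g i \<in> S_pos) \<and>
        \<not> (\<exists>h. common_divisor_mod h (g ` {1..3}) (g 4))"
      using g_linear_and_generating g_positive no_common_divisor by auto
  next
    assume "g 4 \<in> S_deg 1 - {0} \<and> (\<forall>i\<in>{1..3}. g i \<in> S_pos) \<and>
        \<not> (\<exists>h. common_divisor_mod h (g ` {1..3}) (g 4))"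
    then interpret generation_criterion A \<alpha> \<theta> g by unfold_locales auto
    show "SPOG A \<and> SPOG_generators A \<theta> \<and> minimal_degree_relation g \<theta>"
      using SPOG_generators g_minimal_degree by (auto simp: SPOG_def)
  qed
qed

end
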